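(* Under Assumptions 1 and 2, let $\bm\pi_2$ be the following policy. Choose $\delta\in(1,2]$ and an integer $L>0$ with $\lfloor\delta^L\rfloor=n$; set $t_k=\lfloor\delta^k\rfloor$ for $k=1,\dots,L-1$ and $t_L=n+1$; set $x_1=\dots=x_{t_1}=0$. For $k=1,\dots,L-1$, compute $$\bm p_k^*\in\arg\min_{\bm p\ge0}\ \sum_{i=1}^md_ip_i+\frac1{t_k}\sum_{j=1}^{t_k}\Big(r_j-\sum_{i=1}^ma_{ij}p_i\Big)^+,$$ and for $t=t_k+1,\dots,\min(t_{k+1},n)$ set $\tilde x_t=1$ if $r_t>\bm a_t^\top\bm p_k^*$ and $0$ otherwise, taking $x_t=\tilde x_t$ if $\sum_{j<t}a_{ij}x_j+a_{it}\tilde x_t\le b_i$ for all $i$, else $x_t=0$. Then $\Delta_n(\bm\pi_2)=O(\sqrt n\log n)$, i.e. there is a constant $K$ independent of $n$ with $\Delta_n(\bm\pi_2)\le K\sqrt n\log n$.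
   Context: Linear program: $\max\sum_{j=1}^n r_jx_j$ s.t. $\sum_{j=1}^n a_{ij}x_j\le b_i$ ($i=1,\dots,m$), $0\le x_j\le1$; $b_i>0$, $d_i=b_i/n$; optimal value $R_n^*$. In the online version $(r_t,\bm a_t)$ is revealed at time $t$ and $x_t$ is chosen irrevocably; $R_n(\bm\pi)=\sum_tr_tx_t$. Assumption 1: (a) $(r_j,\bm a_j)\in\mathbb R\times\mathbb R^m$ i.i.d. from an unknown $\mathcal P$; (b) $|r_j|\le\bar r$, $\|\bm a_j\|_2\le\bar a$; (c) $d_i\in(\underline d,\bar d)$, $0<\underline d<\bar d$, $\Omega_d=\prod_i(\underline d,\bar d)$; (d) $n>m$. $f(\bm p)=\bm d^\top\bm p+\mathbb E[(r-\bm a^\top\bm p)^+]$; $\bm p^*$ its minimizer over $\bm p\ge0$; $\Omega_p=\{\bm p\ge0:\sum_ip_i\le\bar r/\underline d\}$. Assumption 2 (constants $\lambda_{\min},\lambda,\mu>0$): (a) $\mathbb E[\bm a\bm a^\top]$ positive definite, min eigenvalue $\lambda_{\min}$; (b) for every $\bm d\in\Omega_d$ (with corresponding $\bm p^*$) and all $\bm p\in\Omega_p$: $\lambda|\bm a^\top\bm p-\bm a^\top\bm p^*|\le|\mathbb P(r>\bm a^\top\bm p\mid\bm a)-\mathbb P(r>\bm a^\top\bm p^*\mid\bm a)|\le\mu|\bm a^\top\bm p-\bm a^\top\bm p^*|$; (c) $p_i^*=0$ iff $d_i-\mathbb E[a_iI(r>\bm a^\top\bm p^* )]>0$. $\Xi$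 = family of such $\mathcal P$. Worst-case regret $\Delta_n(\bm\pi)=\sup_{\mathcal P\in\Xi}\mathbb E_{\mathcal P}[R_n^*-R_n(\bm\pi)]$; big-O treats $m$ and assumption constants as fixed. *)

theory Defs
  imports "HOL-Probability.Probability"
begin

text \<open>
  An arrival is a pair \<open>(r, a)\<close> of a reward and a column of resource requirements.  A sample path
  \<open>\<omega>\<close> assigns the arrival \<open>(r\<^sub>t, a\<^sub>t) = \<omega> t\<close> to each time \<open>t = 1, \<dots>, n\<close>; i.i.d. sampling from \<open>P\<close>
  means that \<open>\<omega>\<close> has law \<open>\<Pi>\<^sub>M t\<in>{1..n}. P\<close>.
\<close>

type_synonym 'm arrival = "real \<times> (real ^ 'm)"
type_synonym 'm sample_path = "nat \<Rightarrow> 'm arrival"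

section \<open>The offline linear program\<close>

definition lp_feasible :: "nat \<Rightarrow> real ^ 'm \<Rightarrow> 'm sample_path \<Rightarrow> (nat \<Rightarrow> real) \<Rightarrow> bool" where
  "lp_feasible n b \<omega> x \<longleftrightarrow>
     (\<forall>i. (\<Sum>j=1..n. snd (\<omega> j) $ i * x j) \<le> b $ i) \<and> (\<forall>j\<in>{1..n}. 0 \<le> x j \<and> x j \<le> 1)"

definition reward :: "nat \<Rightarrow> 'm sample_path \<Rightarrow> (nat \<Rightarrow> real) \<Rightarrow> real" where
  "reward n \<omega> x = (\<Sum>j=1..n. fst (\<omega> j) * x j)"

definition lp_value :: "nat \<Rightarrow> real ^ 'm \<Rightarrow> 'm sample_path \<Rightarrow> real" where
  "lp_value n b \<omega> = Sup (reward n \<omega> ` {x. lp_feasible n b \<omega> x})"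

section \<open>The class of distributions\<close>

definition nonneg_vec :: "real ^ 'm \<Rightarrow> bool" where
  "nonneg_vec p \<longleftrightarrow> (\<forall>i. 0 \<le> p $ i)"

definition Omega_d :: "real \<Rightarrow> real \<Rightarrow> (real ^ 'm) set" where
  "Omega_d d_lo d_hi = {d. \<forall>i. d_lo < d $ i \<and> d $ i < d_hi}"

definition Omega_p :: "real \<Rightarrow> real \<Rightarrow> (real ^ 'm) set" where
  "Omega_p r_bar d_lo = {p. nonneg_vec p \<and> (\<Sum>i\<in>UNIV. p $ i) \<le> r_bar / d_lo}"

definition dual_obj :: "'m arrival measure \<Rightarrow> real ^ 'm \<Rightarrow> real ^ 'm \<Rightarrow> real" where
  "dual_obj P d p = d \<bullet> p + (\<integral>z. max 0 (fst z - snd z \<bullet> p) \<partial>P)"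

definition dual_opt :: "'m arrival measure \<Rightarrow> real ^ 'm \<Rightarrow> real ^ 'm \<Rightarrow> bool" where
  "dual_opt P d p \<longleftrightarrow> is_arg_min (dual_obj P d) nonneg_vec p"

text \<open>The conditional probability \<open>\<P>(r > a\<^sup>T p | a)\<close>, a random variable on the space of arrivals.\<close>

definition accept_prob :: "'m arrival measure \<Rightarrow> real ^ 'm \<Rightarrow> 'm arrival \<Rightarrow> real" where
  "accept_prob P p =
     real_cond_exp P (vimage_algebra (space P) snd borel) (indicator {z. fst z > snd z \<bullet> p})"

definition second_moment :: "'m arrival measure \<Rightarrow> real ^ 'm ^ 'm" where
  "second_moment P = (\<chi> i j. \<integral>z. snd z $ i * snd z $ j \<partial>P)"

definition positive_definite :: "real ^ 'm ^ 'm \<Rightarrow> bool" where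
  "positive_definite M \<longleftrightarrow> transpose M = M \<and> (\<forall>v. v \<noteq> 0 \<longrightarrow> 0 < v \<bullet> (M *v v))"

definition is_eigenvalue :: "real ^ 'm ^ 'm \<Rightarrow> real \<Rightarrow> bool" where
  "is_eigenvalue M c \<longleftrightarrow> (\<exists>v. v \<noteq> 0 \<and> M *v v = c *\<^sub>R v)"

definition is_min_eigenvalue :: "real ^ 'm ^ 'm \<Rightarrow> real \<Rightarrow> bool" where
  "is_min_eigenvalue M c \<longleftrightarrow> is_eigenvalue M c \<and> (\<forall>c'. is_eigenvalue M c' \<longrightarrow> c \<le> c')"

text \<open>
  The two-sided bound on the conditional probabilities is required for every right-hand side in
  \<open>Omega_d\<close>; strict complementarity only for the right-hand side \<open>d\<close> of the instance at hand, so
  the class depends on \<open>d\<close>.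
\<close>

definition Xi ::
  "real \<Rightarrow> real \<Rightarrow> real \<Rightarrow> real \<Rightarrow> real \<Rightarrow> real \<Rightarrow> real \<Rightarrow> real ^ 'm \<Rightarrow> 'm arrival measure set" where
  "Xi r_bar a_bar d_lo d_hi lam_min lam mu d =
     {P. prob_space P \<and> sets P = sets borel \<and>
         (AE z in P. \<bar>fst z\<bar> \<le> r_bar \<and> norm (snd z) \<le> a_bar) \<and>
         positive_definite (second_moment P) \<and>
         is_min_eigenvalue (second_moment P) lam_min \<and>
         (\<forall>d'\<in>Omega_d d_lo d_hi. \<forall>p_opt. dual_opt P d' p_opt \<longrightarrow>
            (\<forall>p\<in>Omega_p r_bar d_lo. AE z in P.
               lam * \<bar>snd z \<bullet> p - snd z \<bullet> p_opt\<bar> \<le> \<bar>accept_prob P p z - accept_prob P p_opt z\<bar> \<and>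
               \<bar>accept_prob P p z - accept_prob P p_opt z\<bar> \<le> mu * \<bar>snd z \<bullet> p - snd z \<bullet> p_opt\<bar>)) \<and>
         (\<forall>p_opt. dual_opt P d p_opt \<longrightarrow>
            (\<forall>i. p_opt $ i = 0 \<longleftrightarrow>
               0 < d $ i - (\<integral>z. snd z $ i * indicator {z. fst z > snd z \<bullet> p_opt} z \<partial>P)))}"

text \<open>
  A policy is given by the decisions \<open>\<pi> \<omega> t\<close> it takes along the sample path \<open>\<omega>\<close>.
\<close>

definition worst_case_regret ::
  "'m arrival measure set \<Rightarrow> nat \<Rightarrow> real ^ 'm \<Rightarrow> ('m sample_path \<Rightarrow> nat \<Rightarrow> real) \<Rightarrow> ereal" where
  "worst_case_regret \<P> n b \<pi> =
     (SUP P\<in>\<P>. ereal (\<integral>\<omega>. lp_value n b \<omega> - reward n \<omega> (\<pi> \<omega>) \<partial>(\<Pi>\<^sub>M t\<in>{1..n}. P)))"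

section \<open>The dynamic learning policy\<close>

definition epoch :: "real \<Rightarrow> nat \<Rightarrow> nat \<Rightarrow> nat \<Rightarrow> nat" where
  "epoch \<delta> L n k = (if k = L then n + 1 else nat \<lfloor>\<delta> ^ k\<rfloor>)"

definition sample_dual_obj :: "nat \<Rightarrow> real ^ 'm \<Rightarrow> 'm sample_path \<Rightarrow> real ^ 'm \<Rightarrow> real" where
  "sample_dual_obj t d \<omega> p =
     d \<bullet> p + 1 / real t * (\<Sum>j=1..t. max 0 (fst (\<omega> j) - snd (\<omega> j) \<bullet> p))"

text \<open>
  The sample minimiser need not be unique.  A price rule picks, for every epoch \<open>k\<close>, one minimiser
  as a measurable function of the first \<open>t\<^sub>k\<close> arrivals only, hence non-anticipatively.
\<close>

definition price_rule ::
  "real \<Rightarrow> nat \<Rightarrow> nat \<Rightarrow> real ^ 'm \<Rightarrow> (nat \<Rightarrow> 'm sample_path \<Rightarrow> real ^ 'm) \<Rightarrow> bool" where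
  "price_rule \<delta> L n d q \<longleftrightarrow>
     (\<forall>k\<in>{1..<L}. let t = epoch \<delta> L n k; H = (\<Pi>\<^sub>M j\<in>{1..t}. borel) in
        q k \<in> borel_measurable H \<and>
        (\<forall>h\<in>space H. is_arg_min (sample_dual_obj t d h) nonneg_vec (q k h)))"

text \<open>
  For \<open>t\<^sub>1 < t \<le> n\<close> exactly one epoch \<open>k\<close> satisfies \<open>t\<^sub>k < t \<le> t\<^sub>k\<^sub>+\<^sub>1\<close>; for \<open>t \<le> t\<^sub>1\<close> there is none, so
  the tentative decision is then \<open>0\<close>.
\<close>

definition tentative ::
  "real \<Rightarrow> nat \<Rightarrow> nat \<Rightarrow> (nat \<Rightarrow> 'm sample_path \<Rightarrow> real ^ 'm) \<Rightarrow> 'm sample_path \<Rightarrow> nat \<Rightarrow> real" where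
  "tentative \<delta> L n q \<omega> t =
     (if \<exists>k\<in>{1..<L}. epoch \<delta> L n k < t \<and> t \<le> min (epoch \<delta> L n (k + 1)) n \<and>
           fst (\<omega> t) > snd (\<omega> t) \<bullet> q k (restrict \<omega> {1..epoch \<delta> L n k})
      then 1 else 0)"

context
  notes sum.cong [fundef_cong]
begin

fun capped :: "real ^ 'm \<Rightarrow> 'm sample_path \<Rightarrow> (nat \<Rightarrow> real) \<Rightarrow> nat \<Rightarrow> real" where
  "capped b \<omega> y t =
     (if \<forall>i. (\<Sum>j\<in>{1..<t}. snd (\<omega> j) $ i * capped b \<omega> y j) + snd (\<omega> t) $ i * y t \<le> b $ i
      then y t else 0)"

end

declare capped.simps [simp del]

definition dynamic_policy ::
  "real \<Rightarrow> nat \<Rightarrow> nat \<Rightarrow> real ^ 'm \<Rightarrow> (nat \<Rightarrow> 'm sample_path \<Rightarrow> real ^ 'm) \<Rightarrow> 'm sample_path \<Rightarrow> nat \<Rightarrow> real" where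
  "dynamic_policy \<delta> L n b q \<omega> = capped b \<omega> (tentative \<delta> L n q \<omega>)"

end

theory Submission
  imports Defs
begin

text \<open>
  Let \<open>p_star\<close> be the optimal price of the stochastic dual and compare the policy with the rule that
  accepts arrival \<open>t\<close> iff \<open>r\<^sub>t > a\<^sub>t \<bullet> p_star\<close>.  By weak duality and complementary slackness the expected
  optimal value is at most the expected reward of this rule when its budget is ignored.  Hence the
  regret is bounded by the number of periods in which the tentative decision differs from it, plus
  the number of refusals.  A refusal at \<open>T\<close> means that the tentative consumption up to \<open>T\<close> exceeds
  \<open>n d\<^sub>i\<close> for some \<open>i\<close>, while the fixed-price consumption, a sum of i.i.d. terms of mean at most \<open>d\<^sub>i\<close>,
  stays below \<open>T d\<^sub>i + O(sqrt (n ln n))\<close>; so \<open>n - T\<close> is controlled by the same number of differences.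

  Conditionally on the past, the decisions at \<open>t\<close> differ with probability at most a constant times the
  distance of the price in use to \<open>p_star\<close>.  The dual objective grows quadratically around \<open>p_star\<close>, and
  Hoeffding's inequality on a grid of mesh \<open>1/n\<close>, with deviations proportional to the distance to
  \<open>p_star\<close>, shows that a sample minimiser over \<open>t\<^sub>k\<close> arrivals is within \<open>O(sqrt (ln n / t\<^sub>k))\<close>.  As
  \<open>t \<le> 4 t\<^sub>k\<close> whenever the \<open>k\<close>-th price is used at \<open>t\<close>, summing over \<open>t\<close> gives \<open>O(sqrt (n ln n))\<close>.
\<close>

section \<open>Preliminaries: quadratic forms, a root sum, concentration in product spaces\<close>

text \<open>Rayleigh quotient argument: a minimiser \<open>u\<close> of the form on the unit sphere
  is an eigenvector for the minimal value \<open>e\<close>, so \<open>c \<le> e\<close>; homogeneity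
  does the rest.\<close>

lemma min_eigenvalue_le_quadratic_form:
  fixes M :: "real ^ 'm ^ 'm"
  assumes sym: "transpose M = M" and min: "\<And>c'. is_eigenvalue M c' \<Longrightarrow> c \<le> c'"
  shows "c * (norm v)\<^sup>2 \<le> v \<bullet> (M *v v)"
proof -
  let ?S = "sphere (0::real^'m) 1"
  have "continuous_on ?S (\<lambda>v. v \<bullet> (M *v v))"
    by (intro continuous_intros linear_continuous_on_compose[OF continuous_on_id, of "(*v) M"]) auto
  moreover have "?S \<noteq> {}" by simp
  ultimately obtain u where u: "u \<in> ?S" and umin: "\<And>v. v \<in> ?S \<Longrightarrow> u \<bullet> (M *v u) \<le> v \<bullet> (M *v v)"
    using continuous_attains_inf[of ?S "\<lambda>v. v \<bullet> (M *v v)"] by auto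
  define e where "e = u \<bullet> (M *v u)"
  have nu: "norm u = 1" using u by simp
  have uu: "u \<bullet> u = 1" using nu by (simp add: dot_square_norm)
  have low: "e * (norm w)\<^sup>2 \<le> w \<bullet> (M *v w)" for w
  proof (cases "w = 0")
    case False
    have "e \<le> (w /\<^sub>R norm w) \<bullet> (M *v (w /\<^sub>R norm w))"
      unfolding e_def using False by (intro umin) simp
    also have "\<dots> = (w \<bullet> (M *v w)) / (norm w)\<^sup>2"
      by (simp add: matrix_vector_mult_scaleR power2_eq_square divide_inverse)
    finally show ?thesis using False by (simp add: field_simps)
  qed simp
  have symd: "x \<bullet> (M *v y) = y \<bullet> (M *v x)" for x y
    by (metis dot_lmul_matrix inner_commute sym transpose_matrix_vector)
  \<comment> \<open>Moving from \<open>u\<close> against the residual \<open>w\<close> changes the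
    form minus \<open>e\<close> times the squared norm by
    \<open>s\<^sup>2 * Q - 2 * s * (w \<bullet> w)\<close>. For small \<open>s\<close> the linear
    term would make this negative unless \<open>w = 0\<close>.\<close>
  have "M *v u = e *\<^sub>R u"
  proof -
    define w where "w = M *v u - e *\<^sub>R u"
    have wu: "w \<bullet> u = 0"
      unfolding w_def by (simp add: inner_diff_left inner_diff_right uu e_def inner_commute)
    have ww: "w \<bullet> (M *v u) = w \<bullet> w"
      unfolding w_def[symmetric] using wu by (simp add: w_def inner_diff_right) 
    define Q where "Q = w \<bullet> (M *v w) - e * (norm w)\<^sup>2"
    have Q0: "0 \<le> Q" using low[of w] by (simp add: Q_def)
    have key: "0 \<le> s\<^sup>2 * Q - 2 * s * (w \<bullet> w)" for s
    proof -
      have "e * (norm (u - s *\<^sub>R w))\<^sup>2 \<le> (u - s *\<^sub>R w) \<bullet> (M *v (u - s *\<^sub>R w))"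
        by (rule low)
      moreover have "(norm (u - s *\<^sub>R w))\<^sup>2 = 1 + s\<^sup>2 * (norm w)\<^sup>2"
        using wu uu unfolding power2_norm_eq_inner
        by (simp add: inner_diff_left inner_diff_right inner_commute power2_eq_square)
      moreover have "(u - s *\<^sub>R w) \<bullet> (M *v (u - s *\<^sub>R w)) = e - 2 * s * (w \<bullet> w) + s\<^sup>2 * (w \<bullet> (M *v w))"
        using ww symd[of u w]
        by (simp add: matrix_vector_mult_diff_distrib matrix_vector_mult_scaleR inner_diff_left
            inner_diff_right e_def power2_eq_square algebra_simps)
      ultimately show ?thesis by (simp add: Q_def algebra_simps)
    qed
    have "w \<bullet> w \<le> 0"
    proof (rule ccontr)
      assume "\<not> ?thesis"
      then have pos: "0 < w \<bullet> w" by (simp only: not_le)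
      \<comment> \<open>Small enough that \<open>s * Q \<le> w \<bullet> w\<close>; the
        \<open>+ 1\<close> guards against \<open>Q = 0\<close>.\<close>
      define s where "s = (w \<bullet> w) / (Q + 1)"
      have s: "0 < s" unfolding s_def using pos Q0 by simp
      have "s * (s * Q - 2 * (w \<bullet> w)) \<ge> 0" using key[of s] by (simp add: power2_eq_square algebra_simps)
      then have "2 * (w \<bullet> w) \<le> s * Q" using s by (simp add: zero_le_mult_iff)
      also have "s * Q \<le> w \<bullet> w" unfolding s_def using Q0 pos by (simp add: field_simps)
      finally show False using pos by simp
    qed
    then have "w = 0" by (simp add: order_antisym_conv)
    then show ?thesis by (simp add: w_def)
  qed
  moreover have "u \<noteq> 0" using nu by auto
  ultimately have "c \<le> e" by (intro min) (auto simp: is_eigenvalue_def)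
  then have "c * (norm v)\<^sup>2 \<le> e * (norm v)\<^sup>2" by (intro mult_right_mono) auto
  then show ?thesis using low[of v] by simp
qed

lemma borel_measurable_vec_nth [measurable (raw)]:
  fixes f :: "'a \<Rightarrow> real ^ 'm"
  assumes [measurable]: "f \<in> borel_measurable M"
  shows "(\<lambda>x. f x $ i) \<in> borel_measurable M"
proof -
  have "(\<lambda>x. f x \<bullet> axis i 1) \<in> borel_measurable M" by measurable
  then show ?thesis by (simp add: inner_axis)
qed

text \<open>Each term is at most twice the increment of \<open>sqrt\<close>, so the sum
  telescopes.\<close>

lemma sum_inverse_sqrt_le: "(\<Sum>t=1..n. 1 / sqrt (real t)) \<le> 2 * sqrt (real n)"
proof (induction n)
  case (Suc n)
  have "1 / sqrt (real (Suc n)) \<le> 2 * (sqrt (real (Suc n)) - sqrt (real n))"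
  proof -
    have "(sqrt (real (Suc n)) - sqrt (real n)) * (sqrt (real (Suc n)) + sqrt (real n)) = 1"
      by (simp add: algebra_simps)
    moreover have "sqrt (real (Suc n)) + sqrt (real n) \<le> 2 * sqrt (real (Suc n))" by simp
    ultimately have "1 \<le> (sqrt (real (Suc n)) - sqrt (real n)) * (2 * sqrt (real (Suc n)))"
      by (smt (verit) mult_left_mono of_nat_mono le_add2 plus_1_eq_Suc real_sqrt_le_mono)
    moreover have "0 < sqrt (real (Suc n))" by simp
    ultimately show ?thesis by (subst pos_divide_le_eq) (simp_all only: mult_ac)
  qed
  then show ?case using Suc by simp
qed simp

lemma integral_PiM_component:
  fixes g :: "'a \<Rightarrow> real"
  assumes "prob_space P" "j \<in> I" and [measurable]: "g \<in> borel_measurable P"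
  shows "(\<integral>\<omega>. g (\<omega> j) \<partial>(\<Pi>\<^sub>M t\<in>I. P)) = (\<integral>z. g z \<partial>P)"
    and "integrable (\<Pi>\<^sub>M t\<in>I. P) (\<lambda>\<omega>. g (\<omega> j)) \<longleftrightarrow> integrable P g"
proof -
  have D: "distr (\<Pi>\<^sub>M t\<in>I. P) P (\<lambda>\<omega>. \<omega> j) = P" using assms by (intro distr_PiM_component) auto
  have [measurable]: "(\<lambda>\<omega>. \<omega> j) \<in> measurable (\<Pi>\<^sub>M t\<in>I. P) P"
    using assms(2) by (rule measurable_component_singleton)
  show "(\<integral>\<omega>. g (\<omega> j) \<partial>(\<Pi>\<^sub>M t\<in>I. P)) = (\<integral>z. g z \<partial>P)"
    by (subst (2) D[symmetric]) (simp add: integral_distr)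
  show "integrable (\<Pi>\<^sub>M t\<in>I. P) (\<lambda>\<omega>. g (\<omega> j)) \<longleftrightarrow> integrable P g"
    by (subst (2) D[symmetric]) (simp add: integrable_distr_eq)
qed

text \<open>The threshold is calibrated to give failure probability \<open>2 * exp (- l)\<close>.
  Allowing \<open>s\<close> to exceed the number of terms lets a single threshold serve partial sums
  of every length up to \<open>s\<close>.\<close>

lemma hoeffding_PiM:
  fixes g :: "'a \<Rightarrow> real"
  assumes P: "prob_space P" and I: "finite I" "J \<subseteq> I" and [measurable]: "g \<in> borel_measurable P"
    and B: "AE z in P. \<bar>g z\<bar> \<le> B" and s: "real (card J) \<le> s" and l: "0 \<le> l"
  shows "measure (\<Pi>\<^sub>M t\<in>I. P)
     {\<omega> \<in> space (\<Pi>\<^sub>M t\<in>I. P). B * sqrt (2 * s * l) < \<bar>(\<Sum>j\<in>J. g (\<omega> j)) - real (card J) * (\<integral>z. g z \<partial>P)\<bar>}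
     \<le> 2 * exp (- l)"
proof -
  interpret P: prob_space P by fact
  interpret M: prob_space "\<Pi>\<^sub>M t\<in>I. P" by (rule prob_space_PiM) (rule P)
  interpret PP: product_prob_space "\<lambda>_. P" I by unfold_locales
  let ?M = "\<Pi>\<^sub>M t\<in>I. P"
  have fJ: "finite J" using I finite_subset by auto
  have [measurable]: "(\<lambda>\<omega>. g (\<omega> j)) \<in> borel_measurable ?M" if "j \<in> J" for j
  proof -
    have "j \<in> I" using that I by auto
    then show ?thesis by measurable
  qed
  have BM: "AE \<omega> in ?M. \<bar>g (\<omega> j)\<bar> \<le> B" if "j \<in> J" for j
    using AE_PiM_component[of I "\<lambda>_. P" j "\<lambda>z. \<bar>g z\<bar> \<le> B"] that I B P by auto
  have E: "M.expectation (\<lambda>\<omega>. g (\<omega> j)) = (\<integral>z. g z \<partial>P)" if "j \<in> J" for j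
    using that I by (intro integral_PiM_component P) auto
  have B0: "0 \<le> B"
  proof -
    have "AE z in P. 0 \<le> B" using B by eventually_elim auto
    then show ?thesis by (simp add: P.AE_const)
  qed
  \<comment> \<open>Hoeffding's inequality divides by the sum of squared ranges, which vanishes in
    the first two cases; there the event is empty or null.\<close>
  consider "J = {}" | "B = 0" | "J \<noteq> {}" "0 < B" using B0 by linarith
  then show ?thesis
  proof cases
    case 1
    have "0 \<le> B * sqrt (2 * s * l)" using B0 s l 1 by simp
    then have "{\<omega> \<in> space ?M. B * sqrt (2 * s * l) < \<bar>(\<Sum>j\<in>J. g (\<omega> j)) - real (card J) * (\<integral>z. g z \<partial>P)\<bar>} = {}"
      using 1 by simp
    then show ?thesis by (simp only: measure_empty) simp
  next
    case 2
    have g0: "(\<integral>z. g z \<partial>P) = 0"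
    proof -
      have "(\<integral>z. g z \<partial>P) = (\<integral>z. 0 \<partial>P)" by (intro integral_cong_AE) (use B 2 in auto)
      then show ?thesis by simp
    qed
    have "AE \<omega> in ?M. \<forall>j\<in>J. \<bar>g (\<omega> j)\<bar> \<le> B" using BM fJ by (intro AE_finite_allI) auto
    then have "AE \<omega> in ?M. \<not> (B * sqrt (2 * s * l) < \<bar>(\<Sum>j\<in>J. g (\<omega> j)) - real (card J) * (\<integral>z. g z \<partial>P)\<bar>)"
      by eventually_elim (simp add: 2 g0)
    then have "AE \<omega> in ?M. \<omega> \<notin> {\<omega> \<in> space ?M. B * sqrt (2 * s * l) < \<bar>(\<Sum>j\<in>J. g (\<omega> j)) - real (card J) * (\<integral>z. g z \<partial>P)\<bar>}"
      by eventually_elim auto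
    then have "M.prob {\<omega> \<in> space ?M. B * sqrt (2 * s * l) < \<bar>(\<Sum>j\<in>J. g (\<omega> j)) - real (card J) * (\<integral>z. g z \<partial>P)\<bar>} = 0"
      by (subst M.prob_eq_0) auto
    then show ?thesis by simp
  next
    case 3
    interpret H: Hoeffding_ineq ?M J "\<lambda>j \<omega>. g (\<omega> j)" "\<lambda>_. - B" "\<lambda>_. B" "\<Sum>j\<in>J. M.expectation (\<lambda>\<omega>. g (\<omega> j))"
    proof unfold_locales
      show "finite J" by fact
      have "M.indep_vars (\<lambda>_. P) (\<lambda>j \<omega>. \<omega> j) J"
      proof (subst M.indep_vars_iff_distr_eq_PiM')
        show "(\<lambda>\<omega>. \<omega> j) \<in> measurable ?M P" if "j \<in> J" for j using that I by auto
        have "distr ?M (Pi\<^sub>M J (\<lambda>_. P)) (\<lambda>x. \<lambda>i\<in>J. x i) = Pi\<^sub>M J (\<lambda>_. P)"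
          using PP.distr_restrict[of J I] I by (simp add: restrict_def)
        moreover have "Pi\<^sub>M J (\<lambda>i. distr ?M P (\<lambda>\<omega>. \<omega> i)) = Pi\<^sub>M J (\<lambda>_. P)"
          using I by (intro PiM_cong refl PP.PiM_component) auto
        ultimately show "distr ?M (Pi\<^sub>M J (\<lambda>_. P)) (\<lambda>x. \<lambda>i\<in>J. x i) = Pi\<^sub>M J (\<lambda>i. distr ?M P (\<lambda>\<omega>. \<omega> i))"
          by simp
      qed (use 3 in auto)
      then show "M.indep_vars (\<lambda>_. borel) (\<lambda>j \<omega>. g (\<omega> j)) J"
        by (rule M.indep_vars_compose2) auto
      show "AE x in ?M. g (x i) \<in> {- B..B}" if "i \<in> J" for i
        using BM[OF that] by eventually_elim auto
    qed
    let ?e = "B * sqrt (2 * s * l)"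
    let ?c = "real (card J)"
    have c: "0 < ?c" using 3 fJ by (simp add: card_gt_0_iff)
    have s0: "0 \<le> s" using c s by simp
    have "measure ?M {\<omega> \<in> space ?M. ?e < \<bar>(\<Sum>j\<in>J. g (\<omega> j)) - ?c * (\<integral>z. g z \<partial>P)\<bar>}
      \<le> measure ?M {\<omega> \<in> space ?M. ?e \<le> \<bar>(\<Sum>j\<in>J. g (\<omega> j)) - (\<Sum>j\<in>J. M.expectation (\<lambda>\<omega>. g (\<omega> j)))\<bar>}"
      using E by (intro M.finite_measure_mono) (auto, measurable)
    also have "\<dots> \<le> 2 * exp (-2 * ?e\<^sup>2 / (\<Sum>i\<in>J. (B - (- B))\<^sup>2))"
      using B0 s l s0 3 c by (intro H.Hoeffding_ineq_abs_ge) auto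
    also have "-2 * ?e\<^sup>2 / (\<Sum>i\<in>J. (B - (- B))\<^sup>2) = - (s / ?c * l)"
      using 3 c s0 l by (simp add: power_mult_distrib field_simps)
    also have "2 * exp (- (s / ?c * l)) \<le> 2 * exp (- l)"
      using mult_right_mono[of 1 "s / ?c" l] s c l by simp
    finally show ?thesis .
  qed
qed

section \<open>The dual problem\<close>

locale online_lp =
  fixes P :: "'m::finite arrival measure"
    and r_bar a_bar d_lo d_hi lam_min lam mu :: real and d :: "real ^ 'm"
  assumes P_in_Xi: "P \<in> Xi r_bar a_bar d_lo d_hi lam_min lam mu d"
    and d_in: "d \<in> Omega_d d_lo d_hi"
    and d_lo_pos: "0 < d_lo" and d_lo_less: "d_lo < d_hi"
    and lam_min_pos: "0 < lam_min" and lam_pos: "0 < lam" and mu_pos: "0 < mu"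
begin

sublocale prob_space P
  using P_in_Xi by (simp add: Xi_def)

lemma sets_P: "sets P = sets borel"
  using P_in_Xi by (simp add: Xi_def)

lemma sets_P_prod [measurable_cong]: "sets P = sets (borel \<Otimes>\<^sub>M borel)"
  by (simp only: sets_P borel_prod)

lemma space_P: "space P = UNIV"
  using sets_eq_imp_space_eq[OF sets_P] by simp

lemma AE_bounded: "AE z in P. \<bar>fst z\<bar> \<le> r_bar \<and> norm (snd z) \<le> a_bar"
  using P_in_Xi by (simp add: Xi_def)

lemma r_bar_nonneg: "0 \<le> r_bar" and a_bar_nonneg: "0 \<le> a_bar"
proof -
  have "AE z in P. 0 \<le> r_bar" "AE z in P. 0 \<le> a_bar"
    using AE_bounded by (eventually_elim; smt (verit) norm_ge_zero)+
  then show "0 \<le> r_bar" "0 \<le> a_bar" by (simp_all add: AE_const)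
qed

lemma d_bounds: "d_lo < d $ i" "d $ i < d_hi"
  using d_in by (auto simp: Omega_d_def)

text \<open>Keeps later constants dependent on \<open>d_hi\<close> and the dimension instead of on
  \<open>d\<close>.\<close>

lemma norm_d_le: "norm d \<le> real CARD('m) * d_hi"
proof -
  have "norm d \<le> (\<Sum>i\<in>UNIV. \<bar>d $ i\<bar>)" by (rule norm_le_l1_cart)
  also have "\<dots> \<le> (\<Sum>i\<in>(UNIV::'m set). d_hi)"
  proof (rule sum_mono)
    fix i show "\<bar>d $ i\<bar> \<le> d_hi" using d_bounds[of i] d_lo_pos by simp
  qed
  finally show ?thesis by simp
qed

lemma second_moment_form: "v \<bullet> (second_moment P *v v) = (\<integral>z. (snd z \<bullet> v)\<^sup>2 \<partial>P)"
proof -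
  have int: "integrable P (\<lambda>z. snd z $ i * snd z $ j)" for i j
  proof (rule integrable_const_bound[where B = "a_bar * a_bar"])
    show "AE z in P. norm (snd z $ i * snd z $ j) \<le> a_bar * a_bar"
      using AE_bounded
      by eventually_elim
        (auto simp: abs_mult intro!: mult_mono a_bar_nonneg component_le_norm_cart[THEN order_trans])
  qed measurable
  have "(\<integral>z. (snd z \<bullet> v)\<^sup>2 \<partial>P) = (\<integral>z. (\<Sum>i\<in>UNIV. \<Sum>j\<in>UNIV. v $ i * v $ j * (snd z $ i * snd z $ j)) \<partial>P)"
    by (intro Bochner_Integration.integral_cong refl)
       (simp add: inner_vec_def power2_eq_square sum_product mult_ac)
  also have "\<dots> = (\<Sum>i\<in>UNIV. \<Sum>j\<in>UNIV. v $ i * v $ j * (\<integral>z. snd z $ i * snd z $ j \<partial>P))"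
    using int by (simp add: Bochner_Integration.integral_sum)
  also have "\<dots> = v \<bullet> (second_moment P *v v)"
    by (simp add: inner_vec_def matrix_vector_mult_def second_moment_def sum_distrib_left mult_ac)
  finally show ?thesis by simp
qed

lemma second_moment_ge: "lam_min * (norm v)\<^sup>2 \<le> (\<integral>z. (snd z \<bullet> v)\<^sup>2 \<partial>P)"
  unfolding second_moment_form[symmetric]
  using P_in_Xi
  by (intro min_eigenvalue_le_quadratic_form)
     (auto simp: Xi_def positive_definite_def is_min_eigenvalue_def)

section \<open>Subgradients of the dual objective\<close>

abbreviation acc :: "real ^ 'm \<Rightarrow> 'm arrival \<Rightarrow> real" where
  "acc p z \<equiv> indicator {z. fst z > snd z \<bullet> p} z"

text \<open>\<open>gr p v\<close> pairs a subgradient of the dual objective at \<open>p\<close> with the direction \<open>v\<close>.\<close>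

definition gr :: "real ^ 'm \<Rightarrow> real ^ 'm \<Rightarrow> real" where
  "gr p v = d \<bullet> v - (\<integral>z. (snd z \<bullet> v) * acc p z \<partial>P)"

lemma AE_inner_le: "AE z in P. \<bar>snd z \<bullet> v\<bar> \<le> a_bar * norm v"
  using AE_bounded
  by eventually_elim (meson Cauchy_Schwarz_ineq2 mult_right_mono norm_ge_zero order_trans)

lemma acc_measurable [measurable]: "(\<lambda>z. acc p z) \<in> borel_measurable P"
proof -
  have "{z \<in> space P. fst z > snd z \<bullet> p} \<in> sets P" by measurable
  then have "{z. fst z > snd z \<bullet> p} \<in> sets P" by (simp add: space_P)
  then show ?thesis by simp
qed

lemma integrable_inner_acc: "integrable P (\<lambda>z. (snd z \<bullet> v) * acc p z)"
proof (rule integrable_const_bound[where B = "a_bar * norm v"])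
  show "AE z in P. norm ((snd z \<bullet> v) * acc p z) \<le> a_bar * norm v"
    using AE_inner_le[of v] by eventually_elim (auto simp: indicator_def intro: order_trans[OF abs_ge_zero])
qed measurable

lemma integrable_surplus: "integrable P (\<lambda>z. max 0 (fst z - snd z \<bullet> p))"
proof (rule integrable_const_bound[where B = "r_bar + a_bar * norm p"])
  show "AE z in P. norm (max 0 (fst z - snd z \<bullet> p)) \<le> r_bar + a_bar * norm p"
    using AE_inner_le[of p] AE_bounded by eventually_elim (auto simp: max_def)
qed measurable

text \<open>For a fixed column the rewards accepted under two prices form nested half-lines, so the
  sign of the difference is a function of the column alone. This allows conditioning on the
  column.\<close>

lemma acc_diff_mult: "\<bar>acc p z - acc q z\<bar> = sgn (snd z \<bullet> (q - p)) * (acc p z - acc q z)"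
  by (auto simp: indicator_def sgn_if inner_diff_right)

lemma surplus_eq: "max 0 (fst z - snd z \<bullet> p) = (fst z - snd z \<bullet> p) * acc p z"
  by (auto simp: indicator_def max_def)

lemma gr_scale: "gr p (s *\<^sub>R v) = s * gr p v"
proof -
  have "(\<integral>z. (snd z \<bullet> (s *\<^sub>R v)) * acc p z \<partial>P) = s * (\<integral>z. (snd z \<bullet> v) * acc p z \<partial>P)"
    by (subst Bochner_Integration.integral_mult_right_zero[symmetric])
       (simp only: inner_scaleR_right mult.assoc)
  then show ?thesis by (simp add: gr_def algebra_simps)
qed

text \<open>Integrates the pointwise subgradient inequality of the positive part, with
  \<open>acc p z\<close> as slope.\<close>

lemma dual_obj_subgradient: "dual_obj P d p + gr p (q - p) \<le> dual_obj P d q"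
proof -
  have "(\<integral>z. max 0 (fst z - snd z \<bullet> p) - (snd z \<bullet> (q - p)) * acc p z \<partial>P)
      \<le> (\<integral>z. max 0 (fst z - snd z \<bullet> q) \<partial>P)"
    by (intro integral_mono Bochner_Integration.integrable_diff integrable_surplus integrable_inner_acc)
       (auto simp: indicator_def inner_diff_right max_def)
  moreover have "(\<integral>z. max 0 (fst z - snd z \<bullet> p) - (snd z \<bullet> (q - p)) * acc p z \<partial>P)
     = (\<integral>z. max 0 (fst z - snd z \<bullet> p) \<partial>P) - (\<integral>z. (snd z \<bullet> (q - p)) * acc p z \<partial>P)"
    by (intro Bochner_Integration.integral_diff integrable_surplus integrable_inner_acc)
  ultimately show ?thesis by (simp add: dual_obj_def gr_def inner_diff_right)
qed

section \<open>Conditional acceptance probabilities and the compact price region\<close>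

abbreviation "Op \<equiv> (Omega_p r_bar d_lo :: (real ^ 'm) set)"
abbreviation "colF \<equiv> vimage_algebra (space P) (snd :: 'm arrival \<Rightarrow> real ^ 'm) borel"

lemma subalgebra_colF: "subalgebra P colF"
  unfolding subalgebra_def
proof
  have "(snd :: 'm arrival \<Rightarrow> real ^ 'm) \<in> measurable P borel" by measurable
  then show "sets colF \<subseteq> sets P" by (rule sets_image_in_sets[OF refl])
qed simp

sublocale col: finite_measure_subalgebra P colF
  by unfold_locales (rule subalgebra_colF)

lemma snd_measurable_colF [measurable]: "snd \<in> measurable colF borel"
  by (rule measurable_vimage_algebra1) simp

lemma accept_prob_measurable [measurable]:
  "accept_prob P p \<in> borel_measurable colF" "accept_prob P p \<in> borel_measurable P"
  unfolding accept_prob_def by measurable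

text \<open>Bounded weights depending only on the column cannot tell the indicator from its
  conditional expectation. Through this the assumed bounds on \<open>accept_prob\<close> reach
  integrals of \<open>acc\<close>.\<close>

lemma integrable_mult_accept:
  assumes [measurable]: "h \<in> borel_measurable colF" and h: "AE z in P. \<bar>h z\<bar> \<le> H"
  shows "integrable P (\<lambda>z. h z * acc p z)" "integrable P (\<lambda>z. h z * accept_prob P p z)"
    and "(\<integral>z. h z * accept_prob P p z \<partial>P) = (\<integral>z. h z * acc p z \<partial>P)"
proof -
  have [measurable]: "h \<in> borel_measurable P"
    by (rule measurable_from_subalg[OF subalgebra_colF]) fact
  show *: "integrable P (\<lambda>z. h z * acc p z)"
  proof (rule integrable_const_bound[where B = H])
    show "AE z in P. norm (h z * acc p z) \<le> H"
      using h by eventually_elim (auto simp: indicator_def intro: order_trans[OF abs_ge_zero])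
  qed measurable
  show "integrable P (\<lambda>z. h z * accept_prob P p z)"
    "(\<integral>z. h z * accept_prob P p z \<partial>P) = (\<integral>z. h z * acc p z \<partial>P)"
    unfolding accept_prob_def
    using col.real_cond_exp_intg[OF *] by auto
qed

lemma Op_nonneg: "p \<in> Op \<Longrightarrow> nonneg_vec p"
  by (simp add: Omega_p_def)

lemma norm_Op: "p \<in> Op \<Longrightarrow> norm p \<le> r_bar / d_lo"
  using norm_le_l1_cart[of p] by (simp add: Omega_p_def nonneg_vec_def)

lemma convex_Op: "convex Op"
proof (rule convexI)
  fix x y :: "real ^ 'm" and u v :: real
  assume *: "x \<in> Op" "y \<in> Op" "0 \<le> u" "0 \<le> v" "u + v = 1"
  have "(\<Sum>i\<in>UNIV. (u *\<^sub>R x + v *\<^sub>R y) $ i) = u * (\<Sum>i\<in>UNIV. x $ i) + v * (\<Sum>i\<in>UNIV. y $ i)"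
    by (simp add: sum.distrib sum_distrib_left)
  also have "\<dots> \<le> u * (r_bar / d_lo) + v * (r_bar / d_lo)"
    using * by (intro add_mono mult_left_mono) (auto simp: Omega_p_def)
  also have "\<dots> = r_bar / d_lo" using * by (metis distrib_right mult_1)
  finally show "u *\<^sub>R x + v *\<^sub>R y \<in> Op" using * by (auto simp: Omega_p_def nonneg_vec_def)
qed

lemma zero_Op: "0 \<in> Op"
  using r_bar_nonneg d_lo_pos by (auto simp: Omega_p_def nonneg_vec_def)

lemma d_inner_ge: "nonneg_vec p \<Longrightarrow> d_lo * (\<Sum>i\<in>UNIV. p $ i) \<le> d \<bullet> p"
  unfolding inner_vec_def sum_distrib_left inner_real_def
  by (intro sum_mono mult_right_mono less_imp_le[OF d_bounds(1)]) (auto simp: nonneg_vec_def)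

text \<open>Strictness is what leaves room above a nonzero \<open>p_star\<close> inside
  \<open>Op\<close>, as used in \<open>gr_p_star_axis\<close>.\<close>

lemma d_inner_gt: "nonneg_vec p \<Longrightarrow> p \<noteq> 0 \<Longrightarrow> d_lo * (\<Sum>i\<in>UNIV. p $ i) < d \<bullet> p"
proof -
  assume p: "nonneg_vec p" "p \<noteq> 0"
  then obtain i where "p $ i \<noteq> 0" by (auto simp: vec_eq_iff)
  with p have i: "0 < p $ i" by (metis less_le nonneg_vec_def)
  show ?thesis
    unfolding inner_vec_def sum_distrib_left inner_real_def
  proof (rule sum_strict_mono_ex1)
    show "\<forall>i\<in>UNIV. d_lo * p $ i \<le> d $ i * p $ i"
      using p by (intro ballI mult_right_mono less_imp_le[OF d_bounds(1)]) (auto simp: nonneg_vec_def)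
    show "\<exists>i\<in>UNIV. d_lo * p $ i < d $ i * p $ i"
      using d_bounds(1)[of i] i by (intro bexI[of _ i] mult_strict_right_mono) auto
  qed simp
qed

lemma dual_obj_0_le: "dual_obj P d 0 \<le> r_bar"
proof -
  have "(\<integral>z. max 0 (fst z - snd z \<bullet> 0) \<partial>P) \<le> r_bar"
    by (rule integral_le_const[OF integrable_surplus])
       (use AE_bounded r_bar_nonneg in \<open>auto elim!: eventually_mono\<close>)
  then show ?thesis by (simp add: dual_obj_def)
qed

lemma d_inner_le_dual_obj: "d \<bullet> p \<le> dual_obj P d p"
  unfolding dual_obj_def by (simp add: integral_nonneg)

lemma nonneg_dual_obj_le_in_Op:
  assumes "nonneg_vec p" "dual_obj P d p \<le> r_bar"
  shows "p \<in> Op"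
proof -
  have "d_lo * (\<Sum>i\<in>UNIV. p $ i) \<le> r_bar"
    using d_inner_ge[OF assms(1)] d_inner_le_dual_obj[of p] assms(2) by linarith
  then show ?thesis using assms(1) d_lo_pos by (simp add: Omega_p_def field_simps)
qed

lemma dual_obj_lipschitz: "dual_obj P d q - dual_obj P d p \<le> (norm d + a_bar) * norm (q - p)"
proof -
  have "- gr q (p - q) \<le> (norm d + a_bar) * norm (q - p)"
  proof -
    have "d \<bullet> (q - p) \<le> norm d * norm (q - p)" by (rule norm_cauchy_schwarz)
    moreover have "(\<integral>z. (snd z \<bullet> (p - q)) * acc q z \<partial>P) \<le> a_bar * norm (q - p)"
    proof (rule integral_le_const[OF integrable_inner_acc])
      show "AE z in P. snd z \<bullet> (p - q) * acc q z \<le> a_bar * norm (q - p)"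
        using AE_inner_le[of "p - q"]
        by eventually_elim (auto simp: indicator_def norm_minus_commute)
    qed
    ultimately show ?thesis by (simp add: gr_def inner_diff_right algebra_simps)
  qed
  then show ?thesis using dual_obj_subgradient[of q p] by linarith
qed

lemma continuous_on_dual_obj: "continuous_on S (dual_obj P d)"
proof -
  have "(norm d + a_bar)-lipschitz_on S (dual_obj P d)"
  proof (rule lipschitz_onI)
    fix x y
    show "dist (dual_obj P d x) (dual_obj P d y) \<le> (norm d + a_bar) * dist x y"
      using dual_obj_lipschitz[of x y] dual_obj_lipschitz[of y x]
      by (auto simp: dist_real_def dist_norm norm_minus_commute abs_le_iff)
  qed (use a_bar_nonneg in simp)
  then show ?thesis by (rule lipschitz_on_continuous_on)
qed

lemma compact_Op: "compact Op"
proof -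
  have "closed Op"
  proof -
    have "Op = (\<Inter>i. {p. 0 \<le> p $ i}) \<inter> {p. (\<Sum>i\<in>UNIV. p $ i) \<le> r_bar / d_lo}"
      by (auto simp: Omega_p_def nonneg_vec_def)
    also have "closed \<dots>"
      by (intro closed_Int closed_INT ballI closed_Collect_le continuous_intros)
    finally show ?thesis .
  qed
  moreover have "bounded Op" using norm_Op by (auto simp: bounded_iff)
  ultimately show ?thesis by (simp add: compact_eq_bounded_closed)
qed

text \<open>Nonnegative prices outside the compact set \<open>Op\<close> have objective above
  \<open>r_bar\<close>, hence above the value at \<open>0\<close>, so a minimiser over
  \<open>Op\<close> is a global one.\<close>

lemma dual_opt_exists: "\<exists>p. dual_opt P d p"
proof -
  have "\<exists>p\<in>Op. \<forall>q\<in>Op. dual_obj P d p \<le> dual_obj P d q"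
    by (rule continuous_attains_inf[OF compact_Op _ continuous_on_dual_obj]) (use zero_Op in auto)
  then obtain p where p: "p \<in> Op" "\<And>q. q \<in> Op \<Longrightarrow> dual_obj P d p \<le> dual_obj P d q" by auto
  have "dual_obj P d p \<le> dual_obj P d q" if "nonneg_vec q" for q
    using that p zero_Op dual_obj_0_le nonneg_dual_obj_le_in_Op[of q] by fastforce
  then show ?thesis using p Op_nonneg by (auto simp: dual_opt_def is_arg_min_linorder)
qed

definition p_star :: "real ^ 'm" where "p_star = (SOME p. dual_opt P d p)"

lemma dual_opt_p_star: "dual_opt P d p_star"
  unfolding p_star_def using dual_opt_exists by (rule someI_ex)

lemma p_star_nonneg: "nonneg_vec p_star"
  and p_star_min: "nonneg_vec q \<Longrightarrow> dual_obj P d p_star \<le> dual_obj P d q"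
  using dual_opt_p_star by (auto simp: dual_opt_def is_arg_min_linorder)

lemma dual_obj_p_star_le: "dual_obj P d p_star \<le> r_bar"
  using p_star_min[of 0] dual_obj_0_le by (simp add: nonneg_vec_def)

lemma p_star_Op: "p_star \<in> Op"
  by (intro nonneg_dual_obj_le_in_Op p_star_nonneg dual_obj_p_star_le)

section \<open>First-order conditions and quadratic growth at the optimal price\<close>

lemma accept_prob_bounds:
  assumes "p \<in> Op"
  shows "AE z in P. lam * \<bar>snd z \<bullet> p - snd z \<bullet> p_star\<bar> \<le> \<bar>accept_prob P p z - accept_prob P p_star z\<bar> \<and>
     \<bar>accept_prob P p z - accept_prob P p_star z\<bar> \<le> mu * \<bar>snd z \<bullet> p - snd z \<bullet> p_star\<bar>"
  using P_in_Xi d_in dual_opt_p_star assms unfolding Xi_def by blast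

lemma complementarity:
  "p_star $ i = 0 \<longleftrightarrow> 0 < d $ i - (\<integral>z. snd z $ i * acc p_star z \<partial>P)"
  using P_in_Xi dual_opt_p_star unfolding Xi_def by blast

text \<open>By \<open>acc_diff_mult\<close> the absolute value is a column-dependent sign times a
  signed difference; passing to conditional probabilities makes the \<open>mu\<close> bound
  applicable.\<close>

lemma integral_acc_diff_le:
  assumes "p \<in> Op"
  shows "(\<integral>z. \<bar>acc p z - acc p_star z\<bar> \<partial>P) \<le> mu * a_bar * norm (p - p_star)"
proof -
  let ?h = "\<lambda>z :: 'm arrival. sgn (snd z \<bullet> (p_star - p))"
  have h: "?h \<in> borel_measurable colF" by measurable
  have hb: "AE z in P. \<bar>?h z\<bar> \<le> 1" by (auto simp: sgn_if)
  note H = integrable_mult_accept[OF h hb]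
  have "(\<integral>z. \<bar>acc p z - acc p_star z\<bar> \<partial>P) = (\<integral>z. ?h z * acc p z - ?h z * acc p_star z \<partial>P)"
    unfolding acc_diff_mult by (simp add: right_diff_distrib)
  also have "\<dots> = (\<integral>z. ?h z * accept_prob P p z - ?h z * accept_prob P p_star z \<partial>P)"
    using H by (simp add: Bochner_Integration.integral_diff)
  also have "\<dots> \<le> mu * a_bar * norm (p - p_star)"
  proof (rule integral_le_const)
    show "AE z in P. ?h z * accept_prob P p z - ?h z * accept_prob P p_star z \<le> mu * a_bar * norm (p - p_star)"
      using accept_prob_bounds[OF assms] AE_inner_le[of "p - p_star"]
    proof eventually_elim
      case (elim z)
      have "?h z * accept_prob P p z - ?h z * accept_prob P p_star z \<le> \<bar>accept_prob P p z - accept_prob P p_star z\<bar>"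
        by (auto simp: sgn_if)
      also have "\<dots> \<le> mu * (a_bar * norm (p - p_star))"
        using elim mu_pos by (smt (verit) inner_diff_right mult_left_mono)
      finally show ?case by (simp add: mult_ac)
    qed
  qed (use H in auto)
  finally show ?thesis .
qed

text \<open>Strong monotonicity of the subgradient. The weight \<open>?h\<close> carries the sign of
  the difference of conditional probabilities, so that the product becomes an absolute value to
  which the \<open>lam\<close> bound applies.\<close>

lemma integral_inner_acc_diff_ge:
  assumes "p \<in> Op"
  shows "lam * (\<integral>z. (snd z \<bullet> (p - p_star))\<^sup>2 \<partial>P)
     \<le> (\<integral>z. (snd z \<bullet> (p - p_star)) * (acc p_star z - acc p z) \<partial>P)"
proof -
  let ?v = "p - p_star"
  let ?h = "\<lambda>z :: 'm arrival. \<bar>snd z \<bullet> ?v\<bar> * sgn (accept_prob P p z - accept_prob P p_star z)"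
  have h: "?h \<in> borel_measurable colF" by measurable
  have hb: "AE z in P. \<bar>?h z\<bar> \<le> a_bar * norm ?v"
    using AE_inner_le[of ?v] by eventually_elim (auto simp: sgn_if abs_mult)
  note H = integrable_mult_accept[OF h hb]
  have sq: "integrable P (\<lambda>z. (snd z \<bullet> ?v)\<^sup>2)"
  proof (rule integrable_const_bound[where B = "(a_bar * norm ?v)\<^sup>2"])
    show "AE z in P. norm ((snd z \<bullet> ?v)\<^sup>2) \<le> (a_bar * norm ?v)\<^sup>2"
      using AE_inner_le[of ?v] by eventually_elim (simp add: abs_le_square_iff[symmetric])
  qed measurable
  have "lam * (\<integral>z. (snd z \<bullet> ?v)\<^sup>2 \<partial>P) = (\<integral>z. lam * (snd z \<bullet> ?v)\<^sup>2 \<partial>P)" by simp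
  also have "\<dots> \<le> (\<integral>z. ?h z * accept_prob P p z - ?h z * accept_prob P p_star z \<partial>P)"
  proof (rule integral_mono_AE)
    show "AE z in P. lam * (snd z \<bullet> ?v)\<^sup>2 \<le> ?h z * accept_prob P p z - ?h z * accept_prob P p_star z"
      using accept_prob_bounds[OF assms]
    proof eventually_elim
      case (elim z)
      let ?A = "accept_prob P p z - accept_prob P p_star z"
      have "lam * (snd z \<bullet> ?v)\<^sup>2 = \<bar>snd z \<bullet> ?v\<bar> * (lam * \<bar>snd z \<bullet> p - snd z \<bullet> p_star\<bar>)"
        by (simp add: inner_diff_right[symmetric] power2_eq_square)
      also have "\<dots> \<le> \<bar>snd z \<bullet> ?v\<bar> * \<bar>?A\<bar>" using elim by (intro mult_left_mono) auto
      also have "\<dots> = ?h z * ?A" by (simp add: abs_sgn)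
      finally show ?case by (simp add: right_diff_distrib)
    qed
  qed (use H sq in auto)
  also have "\<dots> = (\<integral>z. ?h z * acc p z - ?h z * acc p_star z \<partial>P)"
    using H by (simp add: Bochner_Integration.integral_diff)
  \<comment> \<open>Nestedness of the acceptance sets makes the right-hand integrand equal to
    \<open>\<bar>snd z \<bullet> ?v\<bar> * \<bar>acc p_star z - acc p z\<bar>\<close>, which
    dominates any choice of sign.\<close>
  also have "\<dots> \<le> (\<integral>z. (snd z \<bullet> ?v) * (acc p_star z - acc p z) \<partial>P)"
  proof (rule integral_mono)
    fix z :: "'m arrival"
    show "?h z * acc p z - ?h z * acc p_star z \<le> (snd z \<bullet> ?v) * (acc p_star z - acc p z)"
      by (auto simp: indicator_def sgn_if inner_diff_right)
    show "integrable P (\<lambda>z. (snd z \<bullet> ?v) * (acc p_star z - acc p z))"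
      unfolding right_diff_distrib by (intro Bochner_Integration.integrable_diff integrable_inner_acc)
  qed (use H in auto)
  finally show ?thesis .
qed

lemma gr_diff: "gr p v - gr q v = (\<integral>z. (snd z \<bullet> v) * (acc q z - acc p z) \<partial>P)"
  unfolding gr_def right_diff_distrib
  by (subst Bochner_Integration.integral_diff) (auto intro: integrable_inner_acc)

lemma gr_diff_le:
  assumes "p \<in> Op"
  shows "gr p v - gr p_star v \<le> a_bar * norm v * (mu * a_bar * norm (p - p_star))"
proof -
  have i: "integrable P (\<lambda>z. \<bar>acc p z - acc p_star z\<bar>)"
    by (rule integrable_const_bound[where B = 1]) (auto simp: indicator_def)
  have "gr p v - gr p_star v \<le> (\<integral>z. a_bar * norm v * \<bar>acc p z - acc p_star z\<bar> \<partial>P)"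
    unfolding gr_diff
  proof (rule integral_mono_AE)
    show "integrable P (\<lambda>z. (snd z \<bullet> v) * (acc p_star z - acc p z))"
      unfolding right_diff_distrib by (intro Bochner_Integration.integrable_diff integrable_inner_acc)
    show "AE z in P. snd z \<bullet> v * (acc p_star z - acc p z) \<le> a_bar * norm v * \<bar>acc p z - acc p_star z\<bar>"
      using AE_inner_le[of v] by eventually_elim (auto simp: indicator_def)
  qed (use i in simp)
  also have "\<dots> \<le> a_bar * norm v * (mu * a_bar * norm (p - p_star))"
    using integral_acc_diff_le[OF assms] a_bar_nonneg by (auto intro!: mult_left_mono)
  finally show ?thesis .
qed

text \<open>By \<open>gr_diff_le\<close> a negative slope at \<open>p_star\<close> towards
  \<open>q\<close> would persist at a nearby point \<open>p\<close> of the segment; the subgradient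
  inequality from \<open>p\<close> back to \<open>p_star\<close> then contradicts
  minimality.\<close>

lemma gr_p_star_nonneg:
  assumes q: "q \<in> Op"
  shows "0 \<le> gr p_star (q - p_star)"
proof (rule ccontr)
  assume neg: "\<not> ?thesis"
  let ?v = "q - p_star"
  define C where "C = a_bar * norm ?v * (mu * a_bar * norm ?v)"
  have C0: "0 \<le> C" unfolding C_def using a_bar_nonneg mu_pos by simp
  \<comment> \<open>The slope changes by at most \<open>s * C\<close> along the step, which this
    choice keeps below half of the assumed negative slope. The cap \<open>1\<close> keeps
    \<open>p\<close> on the segment.\<close>
  define s where "s = min 1 (- gr p_star ?v / (2 * (C + 1)))"
  have s: "0 < s" "s \<le> 1" using neg C0 by (auto simp: s_def field_simps)
  define p where "p = p_star + s *\<^sub>R ?v"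
  have pO: "p \<in> Op"
    using convexD[OF convex_Op p_star_Op q, of "1 - s" s] s by (simp add: p_def algebra_simps)
  have "gr p (p_star - p) \<le> 0"
    using dual_obj_subgradient[of p p_star] p_star_min[OF Op_nonneg[OF pO]] by linarith
  moreover have "p_star - p = (- s) *\<^sub>R ?v" by (simp add: p_def)
  ultimately have "0 \<le> gr p ?v" using s by (simp only: gr_scale) (simp add: zero_le_mult_iff)
  moreover have "gr p ?v - gr p_star ?v \<le> s * C"
    using gr_diff_le[OF pO, of ?v] s by (simp add: p_def C_def mult_ac)
  moreover have "s * C \<le> - gr p_star ?v / 2"
  proof -
    have "s * C \<le> (- gr p_star ?v / (2 * (C + 1))) * C"
      using C0 by (intro mult_right_mono) (auto simp: s_def)
    also have "\<dots> = (- gr p_star ?v / 2) * (C / (C + 1))" by simp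
    also have "\<dots> \<le> (- gr p_star ?v / 2) * 1" using neg C0 by (intro mult_left_mono) auto
    finally show ?thesis by simp
  qed
  ultimately show False using neg by linarith
qed

text \<open>Optimality tested in the direction of the price \<open>0\<close>. This is the part of
  complementary slackness that makes the expected slack in the weak duality bound
  nonpositive.\<close>

lemma gr_p_star_p_star: "gr p_star p_star \<le> 0"
  using gr_p_star_nonneg[OF zero_Op] gr_scale[of p_star "-1" p_star] by simp

lemma inner_axis_eq: "x \<bullet> axis i 1 = x $ i" for x :: "real ^ 'm"
  by (simp add: inner_axis)

text \<open>Says that the fixed-price rule respects the budget on average. A zero price is settled
  by strict complementarity; a positive one by raising coordinate \<open>i\<close> within
  \<open>Op\<close>.\<close>

lemma gr_p_star_axis: "0 \<le> gr p_star (axis i 1)"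
proof (cases "p_star $ i = 0")
  case True
  then show ?thesis using complementarity[of i] by (simp add: gr_def inner_axis_eq)
next
  case False
  \<comment> \<open>The slack of the sum constraint at \<open>p_star\<close>, thus the largest
    admissible increase of one coordinate.\<close>
  define e where "e = r_bar / d_lo - (\<Sum>i\<in>UNIV. p_star $ i)"
  have "p_star \<noteq> 0" using False by auto
  then have "d_lo * (\<Sum>i\<in>UNIV. p_star $ i) < r_bar"
    using d_inner_gt[OF p_star_nonneg] d_inner_le_dual_obj[of p_star] dual_obj_p_star_le by linarith
  then have e: "0 < e" using d_lo_pos by (simp add: e_def field_simps)
  have "p_star + e *\<^sub>R axis i 1 \<in> Op"
    using e p_star_nonneg
    by (auto simp: Omega_p_def nonneg_vec_def sum.distrib sum_distrib_left[symmetric] e_def[symmetric] axis_def)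
       (simp add: e_def)
  from gr_p_star_nonneg[OF this] have "0 \<le> e * gr p_star (axis i 1)" by (simp add: gr_scale)
  then show ?thesis using e by (simp add: zero_le_mult_iff)
qed

text \<open>Applying the subgradient inequality at the midpoint of \<open>p\<close> and \<open>p_star\<close>, and again at
  \<open>p_star\<close>, replaces the second-order Taylor expansion of the dual objective.\<close>

lemma dual_obj_quadratic_growth:
  assumes p: "p \<in> Op"
  shows "lam * lam_min / 4 * (norm (p - p_star))\<^sup>2 \<le> dual_obj P d p - dual_obj P d p_star"
proof -
  let ?v = "p - p_star"
  define c where "c = p_star + (1/2) *\<^sub>R ?v"
  have ceq: "c = (1/2) *\<^sub>R p_star + (1/2) *\<^sub>R p"
    by (simp add: c_def vec_eq_iff field_simps)
  have cO: "c \<in> Op"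
    using convexD[OF convex_Op p_star_Op p, of "1/2" "1/2"]
    unfolding ceq by simp
  have cv: "c - p_star = (1/2) *\<^sub>R ?v" by (simp add: c_def)
  have pc: "p - c = (1/2) *\<^sub>R ?v"
    by (simp add: c_def vec_eq_iff field_simps)
  \<comment> \<open>The halved distance yields the factor 1/4. As \<open>p - c\<close> and
    \<open>c - p_star\<close> coincide, the subgradient at \<open>c\<close> is tested in the same
    direction below.\<close>
  have "lam * (lam_min * (norm (c - p_star))\<^sup>2) \<le> lam * (\<integral>z. (snd z \<bullet> (c - p_star))\<^sup>2 \<partial>P)"
    using lam_pos by (intro mult_left_mono second_moment_ge) auto
  also have "\<dots> \<le> gr c (c - p_star) - gr p_star (c - p_star)"
    unfolding gr_diff by (rule integral_inner_acc_diff_ge[OF cO])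
  finally have 1: "lam * lam_min / 4 * (norm ?v)\<^sup>2 \<le> gr c (c - p_star) - gr p_star (c - p_star)"
    by (simp add: cv power_mult_distrib power_divide)
  have "dual_obj P d c + gr c (c - p_star) \<le> dual_obj P d p"
    using dual_obj_subgradient[of c p] by (simp add: pc cv)
  moreover have "dual_obj P d p_star + gr p_star (c - p_star) \<le> dual_obj P d c"
    by (rule dual_obj_subgradient)
  moreover have "0 \<le> gr p_star (c - p_star)" by (rule gr_p_star_nonneg[OF cO])
  ultimately show ?thesis using 1 by linarith
qed

end

section \<open>Learning the dual price\<close>

text \<open>The root is the solution bound of \<open>quadratic_le_imp_le\<close> for the inequality
  in \<open>sample_opt_close\<close>; \<open>2 * real m\<close> covers rounding to the grid.\<close>

definition price_const :: "nat \<Rightarrow> real \<Rightarrow> real \<Rightarrow> real \<Rightarrow> real" where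
  "price_const m a_bar d_hi c =
     sqrt (2 / c * (2 * ((real m * d_hi + a_bar) * real m) + a_bar\<^sup>2 * (2 * (real m + 1)) / (2 * c)))
     + 2 * real m"

text \<open>The second summand pays for the failure event: distance at most \<open>2 * D\<close>,
  probability at most \<open>2 * (D + 1) ^ m / n\<close>, and \<open>1 / n\<close> at most twice the
  rate.\<close>

definition learn_const :: "nat \<Rightarrow> real \<Rightarrow> real \<Rightarrow> real \<Rightarrow> real \<Rightarrow> real" where
  "learn_const m a_bar d_hi c D = price_const m a_bar d_hi c + 8 * D * (D + 1) ^ m"

text \<open>Lets errors of order \<open>1 / n\<close> be absorbed into the learning rate, since
  \<open>ln n\<close> is at least 1/2.\<close>

lemma inverse_le_rate:
  assumes "1 \<le> t" "t \<le> n" "2 \<le> n"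
  shows "1 / real n \<le> 2 * (ln (real n) / real t)" "1 / real n \<le> 2 * sqrt (ln (real n) / real t)"
proof -
  have ln2: "1 / 2 \<le> ln (real n)"
  proof -
    have "ln 2 \<le> ln (real n)" using assms by simp
    then show ?thesis using ln2_ge_two_thirds by linarith
  qed
  have "1 / real n \<le> 1 / real t" using assms by (intro divide_left_mono) auto
  also have "\<dots> \<le> 2 * (ln (real n) / real t)" using ln2 assms by (simp add: field_simps)
  finally show 1: "1 / real n \<le> 2 * (ln (real n) / real t)" .
  have "1 / real n \<le> sqrt (1 / real n)"
    using assms by (intro real_le_rsqrt) (simp add: power2_eq_square field_simps)
  also have "\<dots> \<le> sqrt (4 * (ln (real n) / real t))"
    using ln2 assms by (intro real_sqrt_le_mono order_trans[OF 1]) (simp add: divide_right_mono)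
  also have "\<dots> = 2 * sqrt (ln (real n) / real t)" by (simp only: real_sqrt_mult real_sqrt_four)
  finally show "1 / real n \<le> 2 * sqrt (ln (real n) / real t)" .
qed

text \<open>Completing the square absorbs the cross term into half of the quadratic term.\<close>

lemma quadratic_le_imp_le:
  fixes x \<rho> A B c :: real
  assumes c: "0 < c" and "0 \<le> \<rho>" and le: "c * x\<^sup>2 \<le> A * \<rho>\<^sup>2 + B * x * \<rho>"
  shows "x \<le> sqrt (2 / c * (A + B\<^sup>2 / (2 * c))) * \<rho>"
proof -
  have "0 \<le> (c * x - B * \<rho>)\<^sup>2 / (2 * c)" using c by simp
  also have "\<dots> = c / 2 * x\<^sup>2 - B * x * \<rho> + B\<^sup>2 / (2 * c) * \<rho>\<^sup>2"
    using c by (simp add: power2_eq_square field_simps)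
  finally have "c / 2 * x\<^sup>2 \<le> (A + B\<^sup>2 / (2 * c)) * \<rho>\<^sup>2"
    using le by (simp add: distrib_right)
  then have "2 / c * (c / 2 * x\<^sup>2) \<le> 2 / c * ((A + B\<^sup>2 / (2 * c)) * \<rho>\<^sup>2)"
    using c by (intro mult_left_mono) auto
  moreover have "2 / c * (c / 2 * x\<^sup>2) = x\<^sup>2" using c by simp
  ultimately have "x\<^sup>2 \<le> (2 / c * (A + B\<^sup>2 / (2 * c))) * \<rho>\<^sup>2"
    by (simp only: mult.assoc)
  then have "sqrt (x\<^sup>2) \<le> sqrt ((2 / c * (A + B\<^sup>2 / (2 * c))) * \<rho>\<^sup>2)"
    by (rule real_sqrt_le_mono)
  then have "\<bar>x\<bar> \<le> sqrt (2 / c * (A + B\<^sup>2 / (2 * c))) * \<bar>\<rho>\<bar>"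
    by (simp only: real_sqrt_mult real_sqrt_abs)
  then show ?thesis using assms(2) by simp
qed

context online_lp
begin

section \<open>Uniform deviations over a price grid and the sample minimiser\<close>

abbreviation path :: "nat \<Rightarrow> 'm sample_path measure" where
  "path n \<equiv> \<Pi>\<^sub>M t\<in>{1..n}. P"

definition regular :: "nat set \<Rightarrow> 'm sample_path \<Rightarrow> bool" where
  "regular J \<omega> \<longleftrightarrow> (\<forall>j\<in>J. \<bar>fst (\<omega> j)\<bar> \<le> r_bar \<and> norm (snd (\<omega> j)) \<le> a_bar)"

text \<open>Subtracting the surplus at \<open>p_star\<close> makes the summands proportional to the
  distance of the prices.\<close>

definition xi :: "real ^ 'm \<Rightarrow> 'm arrival \<Rightarrow> real" where
  "xi p z = max 0 (fst z - snd z \<bullet> p) - max 0 (fst z - snd z \<bullet> p_star)"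

text \<open>The threshold scales with the distance of \<open>p\<close> to \<open>p_star\<close>; without this localisation the sample
  minimiser would only be controlled at rate \<open>t powr (-1/4)\<close>.\<close>

definition bad :: "nat \<Rightarrow> nat \<Rightarrow> real ^ 'm \<Rightarrow> 'm sample_path \<Rightarrow> bool" where
  "bad n t p \<omega> \<longleftrightarrow>
     a_bar * norm (p - p_star) * sqrt (2 * real t * ((real CARD('m) + 1) * ln (real n)))
     < \<bar>(\<Sum>j\<in>{1..t}. xi p (\<omega> j)) - real (card {1..t}) * (\<integral>z. xi p z \<partial>P)\<bar>"

text \<open>Rounding a price of \<open>Op\<close> down coordinatewise to multiples of
  \<open>1 / n\<close> lands here, and the size is of order \<open>n ^ m\<close>, affordable in a
  union bound.\<close>

definition grid :: "nat \<Rightarrow> (real ^ 'm) set" where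
  "grid n = Op \<inter> (\<lambda>\<phi>. \<chi> i. real (\<phi> i) / real n) `
     (UNIV \<rightarrow>\<^sub>E {..nat \<lfloor>real n * (r_bar / d_lo)\<rfloor>})"

lemma prob_space_P: "prob_space P" by unfold_locales

lemma prob_space_path: "prob_space (\<Pi>\<^sub>M t\<in>I. P)"
  by (rule prob_space_PiM) (rule prob_space_P)

lemma AE_regular:
  assumes "finite J" "J \<subseteq> I"
  shows "AE \<omega> in (\<Pi>\<^sub>M t\<in>I. P). regular J \<omega>"
  unfolding regular_def
  using assms prob_space_P AE_bounded
  by (intro AE_finite_allI AE_PiM_component[where P = "\<lambda>z. \<bar>fst z\<bar> \<le> r_bar \<and> norm (snd z) \<le> a_bar"]) auto

lemma D_nonneg: "0 \<le> r_bar / d_lo"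
  using r_bar_nonneg d_lo_pos by simp

lemma finite_grid: "finite (grid n)"
  and card_grid_le: "1 \<le> n \<Longrightarrow> real (card (grid n)) \<le> ((r_bar / d_lo + 1) * real n) ^ CARD('m)"
proof -
  let ?N = "nat \<lfloor>real n * (r_bar / d_lo)\<rfloor>"
  let ?F = "(UNIV :: 'm set) \<rightarrow>\<^sub>E {..?N}"
  let ?g = "\<lambda>\<phi>. (\<chi> i. real (\<phi> i) / real n) :: real ^ 'm"
  have F: "finite ?F" by (intro finite_PiE) auto
  then show "finite (grid n)" unfolding grid_def by blast
  assume n: "1 \<le> n"
  have "card (grid n) \<le> card (?g ` ?F)" unfolding grid_def using F by (intro card_mono) auto
  also have "\<dots> \<le> card ?F" by (rule card_image_le[OF F])
  also have "\<dots> = (?N + 1) ^ CARD('m)" by (simp add: card_PiE)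
  finally have "real (card (grid n)) \<le> real ((?N + 1) ^ CARD('m))" by (simp only: of_nat_le_iff)
  also have "\<dots> = (real ?N + 1) ^ CARD('m)" by (simp add: add.commute)
  also have "\<dots> \<le> ((r_bar / d_lo + 1) * real n) ^ CARD('m)"
  proof (rule power_mono)
    have "real ?N \<le> real n * (r_bar / d_lo)" using D_nonneg by (intro of_nat_floor mult_nonneg_nonneg) auto
    then show "real ?N + 1 \<le> (r_bar / d_lo + 1) * real n" using n by (simp add: algebra_simps)
  qed simp
  finally show "real (card (grid n)) \<le> ((r_bar / d_lo + 1) * real n) ^ CARD('m)" .
qed

lemma surplus_lipschitz:
  assumes "norm a \<le> a_bar"
  shows "max 0 (r - a \<bullet> p) - max 0 (r - a \<bullet> q) \<le> a_bar * norm (p - q)"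
proof -
  have "max 0 (r - a \<bullet> p) - max 0 (r - a \<bullet> q) \<le> \<bar>a \<bullet> (p - q)\<bar>"
    by (auto simp: inner_diff_right max_def)
  also have "\<dots> \<le> norm a * norm (p - q)" by (rule Cauchy_Schwarz_ineq2)
  also have "\<dots> \<le> a_bar * norm (p - q)" using assms by (intro mult_right_mono) auto
  finally show ?thesis .
qed

lemma AE_xi_le: "AE z in P. \<bar>xi p z\<bar> \<le> a_bar * norm (p - p_star)"
  using AE_bounded
proof eventually_elim
  case (elim z)
  then show ?case
    using surplus_lipschitz[of "snd z" "fst z" p p_star] surplus_lipschitz[of "snd z" "fst z" p_star p]
    by (auto simp: xi_def abs_le_iff norm_minus_commute)
qed

lemma xi_measurable [measurable]: "xi p \<in> borel_measurable P"
  unfolding xi_def by measurable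

lemma dual_obj_diff: "dual_obj P d p - dual_obj P d p_star = d \<bullet> (p - p_star) + (\<integral>z. xi p z \<partial>P)"
  unfolding dual_obj_def xi_def
  by (subst Bochner_Integration.integral_diff) (auto intro: integrable_surplus simp: inner_diff_right)

text \<open>Splits the sample objective into its population counterpart and centred noise, the
  latter in the form used by \<open>bad\<close>.\<close>

lemma sample_dual_obj_diff:
  assumes "1 \<le> t"
  shows "sample_dual_obj t d \<omega> p - sample_dual_obj t d \<omega> p_star
     = dual_obj P d p - dual_obj P d p_star
       + ((\<Sum>j\<in>{1..t}. xi p (\<omega> j)) - real (card {1..t}) * (\<integral>z. xi p z \<partial>P)) / real t"
proof -
  have "(\<Sum>j\<in>{1..t}. xi p (\<omega> j)) = (\<Sum>j=1..t. max 0 (fst (\<omega> j) - snd (\<omega> j) \<bullet> p))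
     - (\<Sum>j=1..t. max 0 (fst (\<omega> j) - snd (\<omega> j) \<bullet> p_star))"
    by (simp add: xi_def sum_subtractf)
  then show ?thesis
    using assms unfolding dual_obj_diff
    by (simp add: sample_dual_obj_def inner_diff_right diff_divide_distrib)
qed

lemma sample_dual_obj_lipschitz:
  assumes "1 \<le> t" "regular {1..t} \<omega>"
  shows "sample_dual_obj t d \<omega> p - sample_dual_obj t d \<omega> q \<le> (norm d + a_bar) * norm (p - q)"
proof -
  have "sample_dual_obj t d \<omega> p - sample_dual_obj t d \<omega> q = d \<bullet> (p - q) + 1 / real t *
      (\<Sum>j=1..t. max 0 (fst (\<omega> j) - snd (\<omega> j) \<bullet> p) - max 0 (fst (\<omega> j) - snd (\<omega> j) \<bullet> q))"
    by (simp add: sample_dual_obj_def sum_subtractf inner_diff_right algebra_simps)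
  also have "\<dots> \<le> norm d * norm (p - q) + 1 / real t * (\<Sum>j=1..t. a_bar * norm (p - q))"
    using assms by (intro add_mono norm_cauchy_schwarz mult_left_mono sum_mono surplus_lipschitz)
      (auto simp: regular_def)
  also have "\<dots> = (norm d + a_bar) * norm (p - q)" using assms by (simp add: algebra_simps)
  finally show ?thesis .
qed

text \<open>Comparison with the price \<open>0\<close>, as for the population minimiser.\<close>

lemma sample_opt_in_Op:
  assumes "1 \<le> t" "regular {1..t} \<omega>" "is_arg_min (sample_dual_obj t d \<omega>) nonneg_vec q"
  shows "q \<in> Op"
proof -
  have q: "nonneg_vec q" and "sample_dual_obj t d \<omega> q \<le> sample_dual_obj t d \<omega> 0"
    using assms(3) by (auto simp: is_arg_min_linorder nonneg_vec_def)
  moreover have "d \<bullet> q \<le> sample_dual_obj t d \<omega> q"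
    by (simp add: sample_dual_obj_def sum_nonneg)
  moreover have "sample_dual_obj t d \<omega> 0 \<le> r_bar"
  proof -
    have "(\<Sum>j=1..t. max 0 (fst (\<omega> j))) \<le> (\<Sum>j=1..t. r_bar)"
    proof (rule sum_mono)
      fix j assume "j \<in> {1..t}"
      then have "\<bar>fst (\<omega> j)\<bar> \<le> r_bar" using assms(2) by (auto simp: regular_def)
      then show "max 0 (fst (\<omega> j)) \<le> r_bar" using r_bar_nonneg by linarith
    qed
    then show ?thesis using assms by (simp add: sample_dual_obj_def field_simps)
  qed
  ultimately have "d_lo * (\<Sum>i\<in>UNIV. q $ i) \<le> r_bar"
    using d_inner_ge[OF q] by linarith
  then show ?thesis using q d_lo_pos by (simp add: Omega_p_def field_simps)
qed

abbreviation "growth \<equiv> lam * lam_min / 4"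

lemma growth_pos: "0 < growth"
  using lam_pos lam_min_pos by simp

text \<open>The minimiser depends on the sample, so the deviation bound is applied to its grid
  rounding \<open>p\<close>, which is nearly optimal for the sample objective. Quadratic growth
  against noise linear in the distance \<open>?x\<close> leaves a quadratic inequality for
  \<open>?x\<close>.\<close>

lemma sample_opt_close:
  assumes t: "1 \<le> t" "t \<le> n" "2 \<le> n" and reg: "regular {1..t} \<omega>"
    and q: "is_arg_min (sample_dual_obj t d \<omega>) nonneg_vec q"
    and good: "\<And>p. p \<in> grid n \<Longrightarrow> \<not> bad n t p \<omega>"
  shows "norm (q - p_star) \<le> price_const CARD('m) a_bar d_hi growth * sqrt (ln (real n) / real t)"
proof -
  let ?m = "real CARD('m)"
  have qO: "q \<in> Op" by (rule sample_opt_in_Op[OF t(1) reg q])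
  then have q0: "0 \<le> q $ i" for i by (simp add: Omega_p_def nonneg_vec_def)
  \<comment> \<open>Rounding down, rather than to the nearest point, preserves the sum constraint of
    \<open>Op\<close>.\<close>
  define \<phi> where "\<phi> i = nat \<lfloor>real n * q $ i\<rfloor>" for i
  define p :: "real ^ 'm" where "p = (\<chi> i. real (\<phi> i) / real n)"
  have \<phi>: "real (\<phi> i) \<le> real n * q $ i" "real n * q $ i - 1 \<le> real (\<phi> i)" for i
    unfolding \<phi>_def using q0[of i] by simp_all
  have p_le: "p $ i \<le> q $ i" and p0: "0 \<le> p $ i" for i
    using \<phi>[of i] t by (simp_all add: p_def field_simps)
  have p_ge: "q $ i - 1 / real n \<le> p $ i" for i
  proof -
    have "q $ i - 1 / real n = (real n * q $ i - 1) / real n" using t by (simp add: diff_divide_distrib)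
    also have "\<dots> \<le> p $ i" unfolding p_def using \<phi>(2)[of i] by (simp add: divide_right_mono)
    finally show ?thesis .
  qed
  have pO: "p \<in> Op"
    using qO p0 sum_mono[of UNIV "\<lambda>i. p $ i" "\<lambda>i. q $ i"] p_le
    by (fastforce simp: Omega_p_def nonneg_vec_def)
  have pg: "p \<in> grid n"
  proof -
    have "\<phi> i \<le> nat \<lfloor>real n * (r_bar / d_lo)\<rfloor>" for i
    proof -
      have "q $ i \<le> (\<Sum>i\<in>UNIV. q $ i)" using q0 by (intro member_le_sum) auto
      also have "\<dots> \<le> r_bar / d_lo" using qO by (simp add: Omega_p_def)
      finally show ?thesis unfolding \<phi>_def by (intro nat_mono floor_mono mult_left_mono) auto
    qed
    then show ?thesis unfolding grid_def using pO by (auto simp: p_def intro!: image_eqI[of _ _ \<phi>])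
  qed
  have pq: "norm (p - q) \<le> ?m / real n"
  proof -
    have "norm (p - q) \<le> (\<Sum>i\<in>UNIV. \<bar>(p - q) $ i\<bar>)" by (rule norm_le_l1_cart)
    also have "\<dots> \<le> (\<Sum>i\<in>(UNIV :: 'm set). 1 / real n)"
    proof (rule sum_mono)
      fix i show "\<bar>(p - q) $ i\<bar> \<le> 1 / real n" using p_le[of i] p_ge[of i] by simp
    qed
    finally show ?thesis by simp
  qed
  let ?\<rho> = "sqrt (ln (real n) / real t)"
  let ?x = "norm (p - p_star)"
  define C1 where "C1 = (?m * d_hi + a_bar) * ?m"
  define C2 where "C2 = a_bar * sqrt (2 * (?m + 1))"
  have C20: "0 \<le> C2" unfolding C2_def using a_bar_nonneg by simp
  have C10: "0 \<le> C1" unfolding C1_def using a_bar_nonneg d_lo_pos d_lo_less by simp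
  have ln0: "0 < ln (real n)" using t by simp
  have \<rho>2: "?\<rho>\<^sup>2 = ln (real n) / real t" using ln0 by simp
  have "sample_dual_obj t d \<omega> p - sample_dual_obj t d \<omega> p_star \<le> C1 / real n"
  proof -
    have "sample_dual_obj t d \<omega> q \<le> sample_dual_obj t d \<omega> p_star"
      using q p_star_nonneg by (auto simp: is_arg_min_linorder)
    moreover have "sample_dual_obj t d \<omega> p - sample_dual_obj t d \<omega> q \<le> C1 / real n"
    proof -
      have "sample_dual_obj t d \<omega> p - sample_dual_obj t d \<omega> q \<le> (norm d + a_bar) * norm (p - q)"
        by (rule sample_dual_obj_lipschitz[OF t(1) reg])
      also have "\<dots> \<le> (?m * d_hi + a_bar) * (?m / real n)"
        using norm_d_le pq a_bar_nonneg d_lo_pos d_lo_less by (intro mult_mono) auto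
      finally show ?thesis by (simp add: C1_def)
    qed
    ultimately show ?thesis by linarith
  qed
  moreover have "\<bar>((\<Sum>j\<in>{1..t}. xi p (\<omega> j)) - real (card {1..t}) * (\<integral>z. xi p z \<partial>P)) / real t\<bar> \<le> C2 * ?x * ?\<rho>"
  proof -
    have "\<bar>(\<Sum>j\<in>{1..t}. xi p (\<omega> j)) - real (card {1..t}) * (\<integral>z. xi p z \<partial>P)\<bar>
      \<le> a_bar * ?x * sqrt (2 * real t * ((?m + 1) * ln (real n)))"
      using good[OF pg] by (simp add: bad_def not_less)
    \<comment> \<open>Arranged so that a factor \<open>real t\<close> leaves the root and cancels
      the averaging.\<close>
    also have "2 * real t * ((?m + 1) * ln (real n)) = (2 * (?m + 1)) * (ln (real n) / real t) * (real t)\<^sup>2"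
      using t by (simp add: power2_eq_square field_simps)
    also have "a_bar * ?x * sqrt \<dots> = C2 * ?x * ?\<rho> * real t"
      by (simp only: real_sqrt_mult real_sqrt_abs C2_def) simp
    finally show ?thesis using t by (simp add: abs_divide pos_divide_le_eq)
  qed
  moreover have "g \<le> B + C" if "S \<le> B" "\<bar>e\<bar> \<le> C" "g \<le> F" "S = F + e" for g B C S e F :: real
    using that by linarith
  ultimately have "growth * ?x\<^sup>2 \<le> C1 / real n + C2 * ?x * ?\<rho>"
    using dual_obj_quadratic_growth[OF pO] sample_dual_obj_diff[OF t(1), of \<omega> p] by blast
  also have "C1 / real n \<le> 2 * C1 * ?\<rho>\<^sup>2"
    using mult_left_mono[OF inverse_le_rate(1)[OF t] C10] \<rho>2 by (simp add: mult_ac)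
  finally have x: "?x \<le> sqrt (2 / growth * (2 * C1 + C2\<^sup>2 / (2 * growth))) * ?\<rho>"
    using growth_pos ln0 by (intro quadratic_le_imp_le) auto
  have "norm (q - p_star) \<le> norm (p - q) + ?x"
    using norm_triangle_ineq[of "q - p" "p - p_star"] by (simp add: norm_minus_commute)
  also have "norm (p - q) \<le> 2 * ?m * ?\<rho>"
    using pq mult_left_mono[OF inverse_le_rate(2)[OF t], of ?m] by simp
  also note x
  also have "C2\<^sup>2 = a_bar\<^sup>2 * (2 * (?m + 1))" by (simp add: C2_def power_mult_distrib)
  finally show ?thesis by (simp add: price_const_def C1_def algebra_simps)
qed

text \<open>If some grid point is bad, the count is at least 1 and its multiple exceeds any distance
  of two prices in \<open>Op\<close>. Taking expectations of this inequality amounts to the union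
  bound.\<close>

lemma sample_opt_dist_le:
  assumes t: "1 \<le> t" "t \<le> n" "2 \<le> n" and reg: "regular {1..t} \<omega>"
    and q: "is_arg_min (sample_dual_obj t d \<omega>) nonneg_vec q"
  shows "norm (q - p_star) \<le> price_const CARD('m) a_bar d_hi growth * sqrt (ln (real n) / real t)
     + 2 * (r_bar / d_lo) * (\<Sum>p\<in>grid n. of_bool (bad n t p \<omega>))"
proof (cases "\<exists>p\<in>grid n. bad n t p \<omega>")
  case False
  then have "(\<Sum>p\<in>grid n. of_bool (bad n t p \<omega>)) = (0::real)" by (intro sum.neutral) auto
  then show ?thesis using sample_opt_close[OF t reg q] False by auto
next
  case True
  then obtain p where p: "p \<in> grid n" "bad n t p \<omega>" by auto
  have "norm (q - p_star) \<le> norm q + norm p_star" by (rule norm_triangle_ineq4)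
  also have "\<dots> \<le> 2 * (r_bar / d_lo) * 1"
    using norm_Op[OF sample_opt_in_Op[OF t(1) reg q]] norm_Op[OF p_star_Op] by simp
  also have "\<dots> \<le> 2 * (r_bar / d_lo) * (\<Sum>p\<in>grid n. of_bool (bad n t p \<omega>))"
  proof (rule mult_left_mono)
    have "of_bool (bad n t p \<omega>) \<le> (\<Sum>p\<in>grid n. of_bool (bad n t p \<omega>) :: real)"
      by (rule member_le_sum[OF p(1)]) (use finite_grid in auto)
    then show "1 \<le> (\<Sum>p\<in>grid n. of_bool (bad n t p \<omega>) :: real)" using p(2) by simp
  qed (use D_nonneg in auto)
  finally have "norm (q - p_star) \<le> 2 * (r_bar / d_lo) * (\<Sum>p\<in>grid n. of_bool (bad n t p \<omega>))" .
  moreover have "0 \<le> price_const CARD('m) a_bar d_hi growth * sqrt (ln (real n) / real t)"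
    unfolding price_const_def using lam_pos lam_min_pos a_bar_nonneg d_lo_pos d_lo_less t
    by (intro mult_nonneg_nonneg add_nonneg_nonneg real_sqrt_ge_zero divide_nonneg_nonneg) auto
  ultimately show ?thesis by linarith
qed

declare One_nat_def [simp del]

section \<open>Expected distance of a learned price and expected wrong decisions\<close>

lemma bad_measurable:
  assumes "t \<le> n"
  shows "Measurable.pred (path n) (bad k t p)"
proof -
  have [measurable]: "(\<lambda>\<omega>. xi p (\<omega> j)) \<in> borel_measurable (path n)" if "j \<in> {1..t}" for j
  proof -
    have "j \<in> {1..n}" using that assms by auto
    then show ?thesis by measurable
  qed
  show ?thesis unfolding bad_def by measurable
qed

lemma integral_of_bool:
  assumes [measurable]: "Measurable.pred M Q"
  shows "(\<integral>\<omega>. of_bool (Q \<omega>) \<partial>M) = measure M {\<omega> \<in> space M. Q \<omega>}"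
proof -
  have "(\<integral>\<omega>. of_bool (Q \<omega>) \<partial>M) = (\<integral>\<omega>. indicator {\<omega> \<in> space M. Q \<omega>} \<omega> \<partial>M :: real)"
    by (intro Bochner_Integration.integral_cong) (auto simp: indicator_def)
  then show ?thesis by (simp add: Int_absorb2)
qed

lemma integrable_bad:
  assumes "t \<le> n"
  shows "integrable (path n) (\<lambda>\<omega>. of_bool (bad n t p \<omega>) :: real)"
proof -
  interpret M: prob_space "path n" by (rule prob_space_path)
  have [measurable]: "Measurable.pred (path n) (bad n t p)" by (rule bad_measurable) fact
  show ?thesis by (rule M.integrable_const_bound[where B = 1]) auto
qed

text \<open>The exponent is one more than the power of \<open>n\<close> in the grid size, so the
  union bound leaves \<open>1 / n\<close>.\<close>

lemma integral_bad_le: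
  assumes t: "t \<le> n" "1 \<le> n"
  shows "(\<integral>\<omega>. of_bool (bad n t p \<omega>) \<partial>path n) \<le> 2 * (1 / real n ^ (CARD('m) + 1))"
proof -
  have "(\<integral>\<omega>. of_bool (bad n t p \<omega>) \<partial>path n) = measure (path n) {\<omega> \<in> space (path n). bad n t p \<omega>}"
    using t by (intro integral_of_bool bad_measurable)
  also have "\<dots> \<le> 2 * exp (- ((real CARD('m) + 1) * ln (real n)))"
    unfolding bad_def
    by (rule hoeffding_PiM[OF prob_space_P]) (use t AE_xi_le in auto)
  also have "exp (- ((real CARD('m) + 1) * ln (real n))) = 1 / real n ^ (CARD('m) + 1)"
  proof -
    have "exp ((real CARD('m) + 1) * ln (real n)) = real n ^ (CARD('m) + 1)"
      using exp_of_nat_mult[of "CARD('m) + 1" "ln (real n)"] t by (simp add: add.commute)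
    then show ?thesis by (simp add: exp_minus divide_inverse)
  qed
  finally show ?thesis .
qed

lemma restrict_measurable:
  assumes "{1..s} \<subseteq> I"
  shows "(\<lambda>\<omega>. restrict \<omega> {1..s}) \<in> measurable (\<Pi>\<^sub>M t\<in>I. P) (\<Pi>\<^sub>M j\<in>{1..s}. borel)"
proof (rule measurable_restrict)
  fix j assume "j \<in> {1..s}"
  then have "(\<lambda>\<omega>. \<omega> j) \<in> measurable (\<Pi>\<^sub>M t\<in>I. P) P"
    using assms by (intro measurable_component_singleton) auto
  then show "(\<lambda>\<omega>. \<omega> j) \<in> measurable (\<Pi>\<^sub>M t\<in>I. P) borel"
    using measurable_cong_sets[OF refl sets_P] by blast
qed

lemma restrict_in_space: "restrict \<omega> {1..s} \<in> space (\<Pi>\<^sub>M j\<in>{1..s}. borel)"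
  by (simp add: space_PiM)

lemma regular_restrict: "regular {1..s} (restrict \<omega> {1..s}) \<longleftrightarrow> regular {1..s} \<omega>"
  by (simp add: regular_def)

lemma bad_restrict: "bad n s p (restrict \<omega> {1..s}) \<longleftrightarrow> bad n s p \<omega>"
  by (simp add: bad_def)

text \<open>A single component of a price rule, detached from the epoch structure.\<close>

definition sample_rule :: "nat \<Rightarrow> ('m sample_path \<Rightarrow> real ^ 'm) \<Rightarrow> bool" where
  "sample_rule s q \<longleftrightarrow> 1 \<le> s \<and> q \<in> borel_measurable (\<Pi>\<^sub>M j\<in>{1..s}. borel) \<and>
     (\<forall>h\<in>space (\<Pi>\<^sub>M j\<in>{1..s}. borel). is_arg_min (sample_dual_obj s d h) nonneg_vec (q h))"

lemma sample_rule_measurable: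
  assumes "sample_rule s q" "{1..s} \<subseteq> I"
  shows "(\<lambda>\<omega>. q (restrict \<omega> {1..s})) \<in> borel_measurable (\<Pi>\<^sub>M t\<in>I. P)"
  using measurable_compose[OF restrict_measurable[OF assms(2)]] assms(1) by (auto simp: sample_rule_def)

lemma sample_rule_Op:
  assumes "sample_rule s q" "regular {1..s} \<omega>"
  shows "q (restrict \<omega> {1..s}) \<in> Op"
  using assms restrict_in_space[of \<omega> s]
  by (intro sample_opt_in_Op[of s "restrict \<omega> {1..s}"]) (auto simp: sample_rule_def regular_restrict)

lemma integrable_sample_rule_dist:
  assumes q: "sample_rule s q" and s: "s \<le> n"
  shows "integrable (path n) (\<lambda>\<omega>. norm (q (restrict \<omega> {1..s}) - p_star))"
proof -
  interpret M: prob_space "path n" by (rule prob_space_path)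
  have [measurable]: "(\<lambda>\<omega>. q (restrict \<omega> {1..s})) \<in> borel_measurable (path n)"
    by (rule sample_rule_measurable[OF q]) (use s in auto)
  show ?thesis
  proof (rule M.integrable_const_bound[where B = "r_bar / d_lo + r_bar / d_lo"])
    have "AE \<omega> in path n. regular {1..s} \<omega>" by (rule AE_regular) (use s in auto)
    then show "AE \<omega> in path n. norm (norm (q (restrict \<omega> {1..s}) - p_star)) \<le> r_bar / d_lo + r_bar / d_lo"
    proof eventually_elim
      case (elim \<omega>)
      show ?case
        using norm_triangle_ineq4[of "q (restrict \<omega> {1..s})" p_star]
          norm_Op[OF sample_rule_Op[OF q elim]] norm_Op[OF p_star_Op] by simp
    qed
  qed measurable
qed

lemma expected_sample_rule_dist_le:
  assumes q: "sample_rule s q" and s: "s \<le> n" and n: "2 \<le> n"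
  shows "(\<integral>\<omega>. norm (q (restrict \<omega> {1..s}) - p_star) \<partial>path n)
    \<le> learn_const CARD('m) a_bar d_hi growth (r_bar / d_lo) * sqrt (ln (real n) / real s)"
proof -
  let ?D = "r_bar / d_lo"
  let ?m = "CARD('m)"
  let ?\<rho> = "sqrt (ln (real n) / real s)"
  let ?C = "price_const ?m a_bar d_hi growth"
  interpret M: prob_space "path n" by (rule prob_space_path)
  have s1: "1 \<le> s" using q by (simp add: sample_rule_def)
  have "(\<integral>\<omega>. norm (q (restrict \<omega> {1..s}) - p_star) \<partial>path n)
    \<le> (\<integral>\<omega>. ?C * ?\<rho> + 2 * ?D * (\<Sum>p\<in>grid n. of_bool (bad n s p \<omega>)) \<partial>path n)"
  proof (rule integral_mono_AE)
    have "AE \<omega> in path n. regular {1..s} \<omega>" by (rule AE_regular) (use s in auto)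
    then show "AE \<omega> in path n. norm (q (restrict \<omega> {1..s}) - p_star)
      \<le> ?C * ?\<rho> + 2 * ?D * (\<Sum>p\<in>grid n. of_bool (bad n s p \<omega>))"
    proof eventually_elim
      case (elim \<omega>)
      have "is_arg_min (sample_dual_obj s d (restrict \<omega> {1..s})) nonneg_vec (q (restrict \<omega> {1..s}))"
        using q restrict_in_space by (auto simp: sample_rule_def)
      from sample_opt_dist_le[OF s1 s n _ this] elim show ?case
        by (simp only: regular_restrict bad_restrict)
    qed
  qed (intro integrable_sample_rule_dist q s Bochner_Integration.integrable_add integrable_mult_right
      Bochner_Integration.integrable_sum integrable_bad M.integrable_const)+
  also have "\<dots> = ?C * ?\<rho> + 2 * ?D * (\<Sum>p\<in>grid n. \<integral>\<omega>. of_bool (bad n s p \<omega>) \<partial>path n)"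
    using s by (simp add: Bochner_Integration.integral_add integrable_bad M.prob_space)
  finally have 1: "(\<integral>\<omega>. norm (q (restrict \<omega> {1..s}) - p_star) \<partial>path n) \<le> \<dots>" .
  have "(\<Sum>p\<in>grid n. \<integral>\<omega>. of_bool (bad n s p \<omega>) \<partial>path n)
     \<le> (\<Sum>p\<in>grid n. 2 * (1 / real n ^ (?m + 1)))"
    using s n by (intro sum_mono integral_bad_le) auto
  also have "\<dots> \<le> ((?D + 1) * real n) ^ ?m * (2 * (1 / real n ^ (?m + 1)))"
    using card_grid_le[of n] n by (simp add: divide_right_mono)
  also have "\<dots> = 2 * (?D + 1) ^ ?m * (1 / real n)"
    using n by (simp add: power_mult_distrib power_add)
  also have "\<dots> \<le> 2 * (?D + 1) ^ ?m * (2 * ?\<rho>)"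
    using D_nonneg by (intro mult_left_mono inverse_le_rate(2)[OF s1 s n]) auto
  finally have "2 * ?D * (\<Sum>p\<in>grid n. \<integral>\<omega>. of_bool (bad n s p \<omega>) \<partial>path n)
      \<le> 2 * ?D * (2 * (?D + 1) ^ ?m * (2 * ?\<rho>))"
    using D_nonneg by (intro mult_left_mono) auto
  also have "\<dots> = 8 * ?D * (?D + 1) ^ ?m * ?\<rho>" by simp
  finally have 2: "2 * ?D * (\<Sum>p\<in>grid n. \<integral>\<omega>. of_bool (bad n s p \<omega>) \<partial>path n)
      \<le> 8 * ?D * (?D + 1) ^ ?m * ?\<rho>" .
  show ?thesis
    unfolding learn_const_def distrib_right by (rule order_trans[OF 1 add_left_mono[OF 2]])
qed

lemma acc_eq_of_bool: "acc p z = of_bool (snd z \<bullet> p < fst z)"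
  by (simp add: indicator_def)

text \<open>The price depends on the arrivals before \<open>t\<close> only, so integrating out the arrival at \<open>t\<close>
  first turns the Lipschitz bound for a fixed price into one for the random price.\<close>

lemma expected_flip_le:
  assumes q: "sample_rule s q" and t: "s < t" "t \<le> n"
  shows "(\<integral>\<omega>. \<bar>acc (q (restrict \<omega> {1..s})) (\<omega> t) - acc p_star (\<omega> t)\<bar> \<partial>path n)
    \<le> mu * a_bar * (\<integral>\<omega>. norm (q (restrict \<omega> {1..s}) - p_star) \<partial>path n)"
proof -
  interpret M: prob_space "path n" by (rule prob_space_path)
  interpret PS: product_sigma_finite "\<lambda>_ :: nat. P" by unfold_locales
  define I where "I = {1..n} - {t}"
  have ins: "insert t I = {1..n}" and I: "finite I" "t \<notin> I" "{1..s} \<subseteq> I"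
    using t by (auto simp: I_def)
  define Q where "Q \<omega> = q (restrict \<omega> {1..s})" for \<omega>
  define F where "F \<omega> = \<bar>acc (Q \<omega>) (\<omega> t) - acc p_star (\<omega> t)\<bar>" for \<omega>
  define N where "N \<omega> = mu * a_bar * norm (Q \<omega> - p_star)" for \<omega>
  have [measurable]: "Q \<in> borel_measurable (path n)"
    unfolding Q_def by (rule sample_rule_measurable[OF q]) (use t in auto)
  have sn: "s \<le> n" using t by simp
  have [simp]: "1 \<le> t" "t \<le> n" using t by auto
  have [measurable]: "F \<in> borel_measurable (path n)" "N \<in> borel_measurable (path n)"
    unfolding F_def N_def acc_eq_of_bool by measurable
  have Fi: "integrable (path n) F"
    by (rule M.integrable_const_bound[where B = 1]) (auto simp: F_def indicator_def)
  have Ni: "integrable (path n) N"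
    unfolding N_def Q_def by (intro integrable_mult_right integrable_sample_rule_dist q sn)
  have N0: "0 \<le> N \<omega>" for \<omega> using mu_pos a_bar_nonneg by (simp add: N_def)
  have F0: "0 \<le> F \<omega>" for \<omega> by (simp add: F_def)
  \<comment> \<open>Tonelli with the coordinate \<open>t\<close> split off: \<open>path n\<close> is
    the product over \<open>insert t I\<close>.\<close>
  have "(\<integral>\<^sup>+\<omega>. ennreal (F \<omega>) \<partial>path n) = (\<integral>\<^sup>+x. (\<integral>\<^sup>+y. ennreal (F (x(t := y))) \<partial>P) \<partial>(\<Pi>\<^sub>M t\<in>I. P))"
    unfolding ins[symmetric] by (rule PS.product_nn_integral_insert[OF I(1,2)]) (simp add: ins)
  also have "\<dots> \<le> (\<integral>\<^sup>+x. (\<integral>\<^sup>+y. ennreal (N (x(t := y))) \<partial>P) \<partial>(\<Pi>\<^sub>M t\<in>I. P))"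
  proof (rule nn_integral_mono_AE)
    \<comment> \<open>A regular past places the learned price in \<open>Op\<close>, where the
      Lipschitz bound is available.\<close>
    have "AE x in (\<Pi>\<^sub>M t\<in>I. P). regular {1..s} x" by (rule AE_regular) (use I in auto)
    then show "AE x in (\<Pi>\<^sub>M t\<in>I. P).
      (\<integral>\<^sup>+y. ennreal (F (x(t := y))) \<partial>P) \<le> (\<integral>\<^sup>+y. ennreal (N (x(t := y))) \<partial>P)"
    proof eventually_elim
      case (elim x)
      have rx: "restrict (x(t := y)) {1..s} = restrict x {1..s}" for y
        using t by (auto simp: restrict_def)
      let ?q = "q (restrict x {1..s})"
      have qO: "?q \<in> Op" by (rule sample_rule_Op[OF q elim])
      have "(\<integral>\<^sup>+y. ennreal (F (x(t := y))) \<partial>P) = (\<integral>\<^sup>+y. ennreal \<bar>acc ?q y - acc p_star y\<bar> \<partial>P)"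
        unfolding F_def Q_def rx by simp
      also have "\<dots> = ennreal (\<integral>y. \<bar>acc ?q y - acc p_star y\<bar> \<partial>P)"
      proof (rule nn_integral_eq_integral)
        show "integrable P (\<lambda>y. \<bar>acc ?q y - acc p_star y\<bar>)"
          by (rule integrable_const_bound[where B = 1]) (auto simp: indicator_def intro: acc_measurable)
      qed simp
      also have "\<dots> \<le> ennreal (mu * a_bar * norm (?q - p_star))"
        by (rule ennreal_leI) (rule integral_acc_diff_le[OF qO])
      also have "\<dots> = (\<integral>\<^sup>+y. ennreal (N (x(t := y))) \<partial>P)"
        unfolding N_def Q_def rx by (simp add: emeasure_space_1)
      finally show ?case .
    qed
  qed
  also have "\<dots> = (\<integral>\<^sup>+\<omega>. ennreal (N \<omega>) \<partial>path n)"
    unfolding ins[symmetric] by (rule PS.product_nn_integral_insert[OF I(1,2), symmetric]) (simp add: ins)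
  finally have "ennreal (\<integral>\<omega>. F \<omega> \<partial>path n) \<le> ennreal (\<integral>\<omega>. N \<omega> \<partial>path n)"
    using Fi Ni F0 N0 by (simp add: nn_integral_eq_integral)
  then have "(\<integral>\<omega>. F \<omega> \<partial>path n) \<le> (\<integral>\<omega>. N \<omega> \<partial>path n)"
    using N0 by (simp add: integral_nonneg)
  then show ?thesis by (simp add: F_def N_def Q_def)
qed

end

section \<open>Regret along a sample path\<close>

lemma epoch_mono:
  assumes "1 < \<delta>" "k \<le> k'" "k' < L"
  shows "epoch \<delta> L n k \<le> epoch \<delta> L n k'"
proof -
  have "\<delta> ^ k \<le> \<delta> ^ k'" using assms by (intro power_increasing) auto
  then show ?thesis using assms by (simp add: epoch_def nat_mono floor_mono)
qed

text \<open>Take the last epoch starting before \<open>t\<close>. Successive powers grow by at most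
  2 and taking the floor loses at most another factor 2, hence the 4. From \<open>t \<ge> 3\<close>
  on the first epoch, of length at most 2, is over.\<close>

lemma epoch_exists:
  assumes \<delta>: "1 < \<delta>" "\<delta> \<le> 2" and L: "0 < L" and n: "nat \<lfloor>\<delta> ^ L\<rfloor> = n" and t: "3 \<le> t" "t \<le> n"
  obtains k where "k \<in> {1..<L}" "epoch \<delta> L n k < t" "t \<le> min (epoch \<delta> L n (k + 1)) n"
    "1 \<le> epoch \<delta> L n k" "t \<le> 4 * epoch \<delta> L n k"
proof -
  have fl2: "nat \<lfloor>\<delta>\<rfloor> \<le> 2" using \<delta> by linarith
  have "L \<noteq> 1" using fl2 n t by auto
  then have L2: "2 \<le> L" using L by linarith
  let ?A = "{k \<in> {1..<L}. epoch \<delta> L n k < t}"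
  define k where "k = Max ?A"
  have "1 \<in> ?A" using L2 fl2 t by (auto simp: epoch_def)
  then have "?A \<noteq> {}" by blast
  then have kA: "k \<in> ?A" unfolding k_def by (intro Max_in) auto
  then have k: "1 \<le> k" "k < L" "epoch \<delta> L n k < t" by auto
  have ek: "epoch \<delta> L n k = nat \<lfloor>\<delta> ^ k\<rfloor>" using k by (simp add: epoch_def)
  have next_le: "t \<le> epoch \<delta> L n (k + 1)"
  proof (cases "k + 1 = L")
    case True then show ?thesis using t by (simp add: epoch_def)
  next
    case False
    have "k + 1 \<notin> ?A"
    proof
      assume "k + 1 \<in> ?A"
      then have "k + 1 \<le> Max ?A" by (intro Max_ge) auto
      then show False unfolding k_def[symmetric] by simp
    qed
    then show ?thesis using False k by auto
  qed
  have dk: "1 \<le> \<delta> ^ k" using \<delta> by simp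
  have e1: "1 \<le> epoch \<delta> L n k" using dk by (simp add: ek le_nat_iff le_floor_iff)
  have "t \<le> nat \<lfloor>\<delta> ^ (k + 1)\<rfloor>"
  \<comment> \<open>The last epoch is set to \<open>n + 1\<close>, not to the floor of the power;
    there \<open>t \<le> n\<close> gives the bound.\<close>
  proof (cases "k + 1 = L")
    case True then show ?thesis using t n by simp
  next
    case False then show ?thesis using next_le by (simp add: epoch_def)
  qed
  then have "real t \<le> real (nat \<lfloor>\<delta> ^ (k + 1)\<rfloor>)" by (rule of_nat_mono)
  also have "\<dots> \<le> \<delta> ^ (k + 1)" using \<delta> by (intro of_nat_floor) auto
  also have "\<dots> = \<delta> * \<delta> ^ k" by (simp add: power_add)
  also have "\<dots> \<le> 2 * \<delta> ^ k" using \<delta> by (intro mult_right_mono) auto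
  also have "\<dots> < 2 * (real (epoch \<delta> L n k) + 1)" 
  proof -
    have "\<delta> ^ k < real (nat \<lfloor>\<delta> ^ k\<rfloor>) + 1" using dk by (simp add: of_nat_nat)
    then show ?thesis unfolding ek by simp
  qed
  also have "\<dots> \<le> 4 * real (epoch \<delta> L n k)" using e1 by simp
  finally have "t \<le> 4 * epoch \<delta> L n k" by linarith
  then show ?thesis using that[of k] k next_le e1 t by auto
qed

text \<open>Monotone epochs give disjoint intervals, so the existential over epochs has one
  candidate.\<close>

lemma tentative_eq:
  assumes "1 < \<delta>" and k: "k \<in> {1..<L}" "epoch \<delta> L n k < t" "t \<le> min (epoch \<delta> L n (k + 1)) n"
  shows "tentative \<delta> L n q \<omega> t =
    of_bool (fst (\<omega> t) > snd (\<omega> t) \<bullet> q k (restrict \<omega> {1..epoch \<delta> L n k}))"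
proof -
  have uniq: "k' = k" if k': "k' \<in> {1..<L}" "epoch \<delta> L n k' < t" "t \<le> min (epoch \<delta> L n (k' + 1)) n" for k'
  proof (rule ccontr)
    assume "k' \<noteq> k"
    then consider "k + 1 \<le> k'" | "k' + 1 \<le> k" by linarith
    then show False
    proof cases
      case 1
      then show False using epoch_mono[OF assms(1) 1, of L n] k k' by simp
    next
      case 2
      then show False using epoch_mono[OF assms(1) 2, of L n] k k' by simp
    qed
  qed
  have "(\<exists>k\<in>{1..<L}. epoch \<delta> L n k < t \<and> t \<le> min (epoch \<delta> L n (k + 1)) n \<and> A k) \<longleftrightarrow> A k" for A
    using k uniq by blast
  then show ?thesis unfolding tentative_def by simp
qed

lemma tentative_01: "tentative \<delta> L n q \<omega> t \<in> {0, 1}"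
  by (simp add: tentative_def)

lemma capped_cases: "capped b \<omega> y t = y t \<or> capped b \<omega> y t = 0"
  by (subst (1 2) capped.simps) auto

text \<open>The first refusal time \<open>T\<close> is the only one that matters: before it the actual and the tentative
  decisions agree, so it is the tentative consumption that exceeds the budget.\<close>

lemma capped_refusals:
  fixes b :: "real ^ 'm"
  assumes ne: "{t \<in> {1..n}. capped b \<omega> y t \<noteq> y t} \<noteq> {}"
  obtains T i where "T \<in> {1..n}" "b $ i < (\<Sum>j=1..T. snd (\<omega> j) $ i * y j)"
    "card {t \<in> {1..n}. capped b \<omega> y t \<noteq> y t} \<le> n + 1 - T"
proof -
  let ?N = "{t \<in> {1..n}. capped b \<omega> y t \<noteq> y t}"
  define T where "T = Min ?N"
  have TN: "T \<in> ?N" unfolding T_def using ne by (intro Min_in) auto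
  have less: "capped b \<omega> y j = y j" if "1 \<le> j" "j < T" for j
  proof (rule ccontr)
    assume "capped b \<omega> y j \<noteq> y j"
    then have "j \<in> ?N" using that TN by auto
    then have "T \<le> j" unfolding T_def by (intro Min_le) auto
    then show False using that by simp
  qed
  have "\<not> (\<forall>i. (\<Sum>j\<in>{1..<T}. snd (\<omega> j) $ i * capped b \<omega> y j) + snd (\<omega> T) $ i * y T \<le> b $ i)"
  proof
    assume "\<forall>i. (\<Sum>j\<in>{1..<T}. snd (\<omega> j) $ i * capped b \<omega> y j) + snd (\<omega> T) $ i * y T \<le> b $ i"
    then have "capped b \<omega> y T = y T" by (subst capped.simps) (rule if_P)
    then show False using TN by simp
  qed
  then obtain i where i: "b $ i < (\<Sum>j\<in>{1..<T}. snd (\<omega> j) $ i * capped b \<omega> y j) + snd (\<omega> T) $ i * y T"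
    by (auto simp: not_le)
  also have "(\<Sum>j\<in>{1..<T}. snd (\<omega> j) $ i * capped b \<omega> y j) = (\<Sum>j\<in>{1..<T}. snd (\<omega> j) $ i * y j)"
    using less by (intro sum.cong) auto
  also have "\<dots> + snd (\<omega> T) $ i * y T = (\<Sum>j=1..T. snd (\<omega> j) $ i * y j)"
  proof -
    have "{1..T} = insert T {1..<T}" using TN by auto
    then show ?thesis by simp
  qed
  finally have 1: "b $ i < (\<Sum>j=1..T. snd (\<omega> j) $ i * y j)" .
  have "?N \<subseteq> {T..n}" using TN by (auto simp: T_def intro!: Min_le)
  then have "card ?N \<le> card {T..n}" by (intro card_mono) auto
  then show ?thesis using that[of T i] 1 TN by auto
qed

text \<open>Weak duality. Positivity of \<open>b\<close> makes the zero solution feasible, so the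
  supremum is over a nonempty set.\<close>

lemma lp_value_le_dual:
  fixes b :: "real ^ 'm"
  assumes p: "nonneg_vec p" and b: "\<And>i. 0 < b $ i"
  shows "lp_value n b \<omega> \<le> b \<bullet> p + (\<Sum>j=1..n. max 0 (fst (\<omega> j) - snd (\<omega> j) \<bullet> p))"
  unfolding lp_value_def
proof (rule cSup_least)
  have "lp_feasible n b \<omega> (\<lambda>_. 0)" using b by (auto simp: lp_feasible_def less_imp_le)
  then show "reward n \<omega> ` {x. lp_feasible n b \<omega> x} \<noteq> {}" by auto
next
  fix v assume "v \<in> reward n \<omega> ` {x. lp_feasible n b \<omega> x}"
  then obtain x where v: "v = reward n \<omega> x" and x: "lp_feasible n b \<omega> x" by auto
  have "v = (\<Sum>j=1..n. (fst (\<omega> j) - snd (\<omega> j) \<bullet> p) * x j) + (\<Sum>j=1..n. (snd (\<omega> j) \<bullet> p) * x j)"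
    by (simp add: v reward_def sum_subtractf left_diff_distrib)
  also have "(\<Sum>j=1..n. (fst (\<omega> j) - snd (\<omega> j) \<bullet> p) * x j) \<le> (\<Sum>j=1..n. max 0 (fst (\<omega> j) - snd (\<omega> j) \<bullet> p))"
  proof (rule sum_mono)
    fix j assume "j \<in> {1..n}"
    then have xj: "0 \<le> x j" "x j \<le> 1" using x by (auto simp: lp_feasible_def)
    have "(fst (\<omega> j) - snd (\<omega> j) \<bullet> p) * x j \<le> max 0 (fst (\<omega> j) - snd (\<omega> j) \<bullet> p) * x j"
      using xj by (intro mult_right_mono) auto
    also have "\<dots> \<le> max 0 (fst (\<omega> j) - snd (\<omega> j) \<bullet> p) * 1"
      using xj by (intro mult_left_mono) auto
    finally show "(fst (\<omega> j) - snd (\<omega> j) \<bullet> p) * x j \<le> max 0 (fst (\<omega> j) - snd (\<omega> j) \<bullet> p)" by simp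
  qed
  also have "(\<Sum>j=1..n. (snd (\<omega> j) \<bullet> p) * x j) = (\<Sum>i\<in>UNIV. p $ i * (\<Sum>j=1..n. snd (\<omega> j) $ i * x j))"
    unfolding inner_vec_def sum_distrib_left sum_distrib_right
    by (subst sum.swap) (simp add: mult_ac)
  also have "\<dots> \<le> (\<Sum>i\<in>UNIV. p $ i * b $ i)"
    using x p by (intro sum_mono mult_left_mono) (auto simp: lp_feasible_def nonneg_vec_def)
  also have "\<dots> = b \<bullet> p" by (simp add: inner_vec_def mult.commute)
  finally show "v \<le> b \<bullet> p + (\<Sum>j=1..n. max 0 (fst (\<omega> j) - snd (\<omega> j) \<bullet> p))" by simp
qed

context online_lp
begin

section \<open>Regret bound along a regular path\<close>

text \<open>One threshold in \<open>n\<close> serves all \<open>T\<close>. The factor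
  \<open>2 * ln n\<close> gives each event probability at most \<open>2 / n\<^sup>2\<close>, small
  enough to sum over \<open>T\<close> and pay \<open>n\<close> refusals.\<close>

definition overshoot :: "nat \<Rightarrow> 'm \<Rightarrow> nat \<Rightarrow> 'm sample_path \<Rightarrow> bool" where
  "overshoot n i T \<omega> \<longleftrightarrow> a_bar * sqrt (2 * real n * (2 * ln (real n)))
     < \<bar>(\<Sum>j\<in>{1..T}. snd (\<omega> j) $ i * acc p_star (\<omega> j))
        - real (card {1..T}) * (\<integral>z. snd z $ i * acc p_star z \<partial>P)\<bar>"

lemma mean_consumption_le: "(\<integral>z. snd z $ i * acc p_star z \<partial>P) \<le> d $ i"
  using gr_p_star_axis[of i] by (simp add: gr_def inner_axis_eq)

text \<open>At the first refusal \<open>T\<close> tentative consumption exceeds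
  \<open>n * d $ i\<close>, while without overshoot it is at most \<open>T * d $ i\<close> plus
  fluctuation and \<open>a_bar\<close> times the differences; this bounds \<open>n - T\<close>. An
  overshoot is charged all \<open>n\<close> periods. The leading 1 arises because \<open>T\<close>
  itself is refused.\<close>

lemma card_refusals_le:
  fixes y e :: "nat \<Rightarrow> real"
  assumes n: "2 \<le> n" and reg: "regular {1..n} \<omega>" and b: "b = real n *\<^sub>R d"
    and e: "\<And>t. t \<in> {1..n} \<Longrightarrow> \<bar>y t - acc p_star (\<omega> t)\<bar> \<le> e t"
  shows "real (card {t \<in> {1..n}. capped b \<omega> y t \<noteq> y t})
    \<le> 1 + (a_bar * sqrt (2 * real n * (2 * ln (real n))) + a_bar * (\<Sum>t=1..n. e t)) / d_lo
      + real n * (\<Sum>i\<in>UNIV. \<Sum>T=1..n. of_bool (overshoot n i T \<omega>))"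
proof -
  let ?N = "{t \<in> {1..n}. capped b \<omega> y t \<noteq> y t}"
  define w where "w = a_bar * sqrt (2 * real n * (2 * ln (real n)))"
  define D where "D = (\<Sum>t=1..n. e t)"
  let ?Z = "real n * (\<Sum>i\<in>UNIV. \<Sum>T=1..n. of_bool (overshoot n i T \<omega>))"
  have w0: "0 \<le> w" unfolding w_def using n a_bar_nonneg by simp
  have e0: "0 \<le> e t" if "t \<in> {1..n}" for t using e[OF that] by (meson abs_ge_zero order_trans)
  have D0: "0 \<le> D" unfolding D_def using e0 by (intro sum_nonneg) auto
  have Z0: "0 \<le> ?Z" by (intro mult_nonneg_nonneg sum_nonneg) auto
  have wD0: "0 \<le> (w + a_bar * D) / d_lo" using w0 D0 a_bar_nonneg d_lo_pos by simp
  have "real (card ?N) \<le> 1 + (w + a_bar * D) / d_lo + ?Z"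
  proof (cases "?N = {}")
    case True
    then have "card ?N = 0" by (simp only: card.empty)
    then show ?thesis using Z0 wD0 by linarith
  next
    case False
    then obtain T i where T: "T \<in> {1..n}" and over: "b $ i < (\<Sum>j=1..T. snd (\<omega> j) $ i * y j)"
      and card: "card ?N \<le> n + 1 - T" by (rule capped_refusals)
    show ?thesis
    proof (cases "overshoot n i T \<omega>")
      case True
      have "1 = (of_bool (overshoot n i T \<omega>) :: real)" using True by simp
      also have "\<dots> \<le> (\<Sum>T=1..n. of_bool (overshoot n i T \<omega>))"
        by (rule member_le_sum[OF T]) auto
      also have "\<dots> \<le> (\<Sum>i\<in>UNIV. \<Sum>T=1..n. of_bool (overshoot n i T \<omega>))"
        by (rule member_le_sum[of i UNIV "\<lambda>i. \<Sum>T=1..n. of_bool (overshoot n i T \<omega>)"]) (auto intro: sum_nonneg)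
      finally have "real n * 1 \<le> ?Z" by (intro mult_left_mono) auto
      moreover have "real (card ?N) \<le> real n" using card T by auto
      ultimately show ?thesis using wD0 by linarith
    next
      case False
      let ?E = "\<integral>z. snd z $ i * acc p_star z \<partial>P"
      have "real n * d $ i = b $ i" by (simp add: b)
      also note over
      also have "(\<Sum>j=1..T. snd (\<omega> j) $ i * y j)
        \<le> (\<Sum>j=1..T. snd (\<omega> j) $ i * acc p_star (\<omega> j)) + a_bar * D"
      proof -
        have "(\<Sum>j=1..T. snd (\<omega> j) $ i * y j) - (\<Sum>j=1..T. snd (\<omega> j) $ i * acc p_star (\<omega> j))
           = (\<Sum>j=1..T. snd (\<omega> j) $ i * (y j - acc p_star (\<omega> j)))"
          by (simp add: sum_subtractf right_diff_distrib)
        also have "\<dots> \<le> (\<Sum>j=1..T. a_bar * e j)"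
        proof (rule sum_mono)
          fix j assume "j \<in> {1..T}"
          then have j: "j \<in> {1..n}" using T by auto
          have "snd (\<omega> j) $ i * (y j - acc p_star (\<omega> j)) \<le> \<bar>snd (\<omega> j) $ i\<bar> * \<bar>y j - acc p_star (\<omega> j)\<bar>"
            by (rule order_trans[OF abs_ge_self eq_refl[OF abs_mult]])
          also have "\<dots> \<le> a_bar * e j"
          proof (rule mult_mono)
            have "norm (snd (\<omega> j)) \<le> a_bar" using reg j by (auto simp: regular_def)
            then show "\<bar>snd (\<omega> j) $ i\<bar> \<le> a_bar"
              using component_le_norm_cart[of "snd (\<omega> j)" i] by linarith
          qed (use e[OF j] a_bar_nonneg in auto)
          finally show "snd (\<omega> j) $ i * (y j - acc p_star (\<omega> j)) \<le> a_bar * e j" .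
        qed
        also have "\<dots> \<le> (\<Sum>j=1..n. a_bar * e j)"
          using T e0 a_bar_nonneg by (intro sum_mono2) auto
        also have "\<dots> = a_bar * D" by (simp add: D_def sum_distrib_left)
        finally show ?thesis by linarith
      qed
      also have "(\<Sum>j=1..T. snd (\<omega> j) $ i * acc p_star (\<omega> j)) \<le> real T * ?E + w"
        using False by (simp add: overshoot_def w_def not_less abs_le_iff)
      also have "real T * ?E \<le> real T * d $ i"
        by (intro mult_left_mono mean_consumption_le) auto
      finally have "(real n - real T) * d $ i \<le> w + a_bar * D" by (simp add: algebra_simps)
      moreover have "(real n - real T) * d_lo \<le> (real n - real T) * d $ i"
        using T d_bounds(1)[of i] by (intro mult_left_mono) auto
      ultimately have "real n - real T \<le> (w + a_bar * D) / d_lo"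
        using d_lo_pos by (simp add: pos_le_divide_eq)
      moreover have "real (card ?N) \<le> 1 + (real n - real T)" using card T by auto
      ultimately show ?thesis using Z0 by linarith
    qed
  qed
  then show ?thesis by (simp only: w_def D_def)
qed

text \<open>Weak duality at \<open>p_star\<close> bounds the optimum by the fixed-price reward plus
  a slack sum of nonpositive mean. Against that reward, each difference or refusal loses at most
  \<open>r_bar\<close>.\<close>

lemma regret_pathwise_le:
  fixes y e :: "nat \<Rightarrow> real"
  assumes n: "2 \<le> n" and reg: "regular {1..n} \<omega>" and b: "b = real n *\<^sub>R d"
    and y: "\<And>t. y t \<in> {0, 1}"
    and e: "\<And>t. t \<in> {1..n} \<Longrightarrow> \<bar>y t - acc p_star (\<omega> t)\<bar> \<le> e t"
  shows "lp_value n b \<omega> - reward n \<omega> (capped b \<omega> y)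
    \<le> (\<Sum>j=1..n. d \<bullet> p_star - (snd (\<omega> j) \<bullet> p_star) * acc p_star (\<omega> j))
      + r_bar * ((\<Sum>t=1..n. e t)
          + (1 + (a_bar * sqrt (2 * real n * (2 * ln (real n))) + a_bar * (\<Sum>t=1..n. e t)) / d_lo
          + real n * (\<Sum>i\<in>UNIV. \<Sum>T=1..n. of_bool (overshoot n i T \<omega>))))"
proof -
  let ?N = "{t \<in> {1..n}. capped b \<omega> y t \<noteq> y t}"
  have "0 < b $ i" for i using n d_bounds(1)[of i] d_lo_pos by (simp add: b)
  then have "lp_value n b \<omega> \<le> b \<bullet> p_star + (\<Sum>j=1..n. max 0 (fst (\<omega> j) - snd (\<omega> j) \<bullet> p_star))"
    by (intro lp_value_le_dual p_star_nonneg)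
  also have "\<dots> = (\<Sum>j=1..n. d \<bullet> p_star - (snd (\<omega> j) \<bullet> p_star) * acc p_star (\<omega> j))
     + (\<Sum>j=1..n. fst (\<omega> j) * acc p_star (\<omega> j))"
    unfolding surplus_eq by (simp add: b sum_subtractf left_diff_distrib)
  finally have lp: "lp_value n b \<omega> \<le> \<dots>" .
  have "(\<Sum>j=1..n. fst (\<omega> j) * acc p_star (\<omega> j)) - reward n \<omega> (capped b \<omega> y)
      = (\<Sum>j=1..n. fst (\<omega> j) * (acc p_star (\<omega> j) - capped b \<omega> y j))"
    by (simp add: reward_def sum_subtractf right_diff_distrib)
  also have "\<dots> \<le> (\<Sum>j=1..n. r_bar * (e j + of_bool (capped b \<omega> y j \<noteq> y j)))"
  proof (rule sum_mono)
    fix j assume j: "j \<in> {1..n}"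
    have "\<bar>acc p_star (\<omega> j) - capped b \<omega> y j\<bar> \<le> e j + of_bool (capped b \<omega> y j \<noteq> y j)"
      using e[OF j] y[of j] capped_cases[of b \<omega> y j] by (auto simp: indicator_def split: if_splits)
    moreover have "\<bar>fst (\<omega> j)\<bar> \<le> r_bar" using reg j by (auto simp: regular_def)
    ultimately have "\<bar>fst (\<omega> j)\<bar> * \<bar>acc p_star (\<omega> j) - capped b \<omega> y j\<bar>
      \<le> r_bar * (e j + of_bool (capped b \<omega> y j \<noteq> y j))"
      by (intro mult_mono r_bar_nonneg) auto
    then show "fst (\<omega> j) * (acc p_star (\<omega> j) - capped b \<omega> y j)
      \<le> r_bar * (e j + of_bool (capped b \<omega> y j \<noteq> y j))"
      by (rule order_trans[OF order_trans[OF abs_ge_self eq_refl[OF abs_mult]]])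
  qed
  also have "\<dots> = r_bar * ((\<Sum>j=1..n. e j) + real (card ?N))"
  proof -
    have "(\<Sum>j=1..n. of_bool (capped b \<omega> y j \<noteq> y j)) = real (card ?N)"
      by (simp add: Int_def)
    then show ?thesis by (simp only: sum_distrib_left[symmetric] sum.distrib)
  qed
  also have "\<dots> \<le> r_bar * ((\<Sum>t=1..n. e t)
          + (1 + (a_bar * sqrt (2 * real n * (2 * ln (real n))) + a_bar * (\<Sum>t=1..n. e t)) / d_lo
          + real n * (\<Sum>i\<in>UNIV. \<Sum>T=1..n. of_bool (overshoot n i T \<omega>))))"
    by (intro mult_left_mono add_left_mono card_refusals_le r_bar_nonneg n reg b e)
  finally show ?thesis using lp by linarith
qed

end

section \<open>Expected regret\<close>

text \<open>The junk value 0 of a non-integrable Bochner integral is harmless here, so the optimal value of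
  the linear program need not be shown measurable.\<close>

lemma integral_le_nonneg_bound:
  fixes f U :: "'a \<Rightarrow> real"
  assumes "integrable M U" "AE x in M. f x \<le> U x" "(\<integral>x. U x \<partial>M) \<le> K" "0 \<le> K"
  shows "(\<integral>x. f x \<partial>M) \<le> K"
proof (cases "integrable M f")
  case True
  then show ?thesis using integral_mono_AE[OF True assms(1,2)] assms(3) by linarith
qed (use assms(4) in \<open>simp add: not_integrable_integral_eq\<close>)

text \<open>In units of \<open>sqrt n * ln n\<close>, \<open>E\<close> bounds the expected sum of
  \<open>flip\<close>; \<open>2\<close>, \<open>4 * a_bar\<close> and \<open>4 * real m\<close> pay
  for the additive 1, the fluctuation threshold and the overshoots.\<close>

definition regret_const :: "nat \<Rightarrow> real \<Rightarrow> real \<Rightarrow> real \<Rightarrow> real \<Rightarrow> real \<Rightarrow> real \<Rightarrow> real" where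
  "regret_const m r_bar a_bar d_lo d_hi c mu =
     (let E = 4 + 8 * (mu * a_bar * learn_const m a_bar d_hi c (r_bar / d_lo))
      in r_bar * (E + 2 + (4 * a_bar + a_bar * E) / d_lo + 4 * real m))"

context online_lp
begin

text \<open>No price is guaranteed to be available up to time \<open>t\<^sub>1 \<le> 2\<close>, so these periods are charged in
  full.\<close>

definition flip :: "real \<Rightarrow> nat \<Rightarrow> nat \<Rightarrow> (nat \<Rightarrow> 'm sample_path \<Rightarrow> real ^ 'm) \<Rightarrow> nat \<Rightarrow> 'm sample_path \<Rightarrow> real" where
  "flip \<delta> L n q t \<omega> = (if t \<le> 2 then 1 else \<bar>tentative \<delta> L n q \<omega> t - acc p_star (\<omega> t)\<bar>)"

lemma abs_tentative_diff_le_flip: "\<bar>tentative \<delta> L n q \<omega> t - acc p_star (\<omega> t)\<bar> \<le> flip \<delta> L n q t \<omega>"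
  by (auto simp: flip_def tentative_def indicator_def)

lemma learn_const_nonneg: "0 \<le> learn_const CARD('m) a_bar d_hi growth (r_bar / d_lo)"
  unfolding learn_const_def price_const_def
  using lam_pos lam_min_pos a_bar_nonneg d_lo_pos d_lo_less r_bar_nonneg
  by (intro mult_nonneg_nonneg add_nonneg_nonneg real_sqrt_ge_zero divide_nonneg_nonneg) auto

text \<open>Combines \<open>expected_flip_le\<close> with the learning rate;
  \<open>t \<le> 4 * s\<close> for sample size \<open>s\<close> costs a factor 2 after the
  root.\<close>

lemma expected_flip:
  assumes \<delta>: "1 < \<delta>" "\<delta> \<le> 2" and L: "0 < L" and n: "nat \<lfloor>\<delta> ^ L\<rfloor> = n" "2 \<le> n"
    and q: "price_rule \<delta> L n d q" and t: "t \<in> {1..n}"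
  shows "integrable (path n) (flip \<delta> L n q t)"
    and "(\<integral>\<omega>. flip \<delta> L n q t \<omega> \<partial>path n) \<le> of_bool (t \<le> 2)
      + 2 * (mu * a_bar * learn_const CARD('m) a_bar d_hi growth (r_bar / d_lo)) * sqrt (ln (real n))
        * (1 / sqrt (real t))"
proof -
  interpret M: prob_space "path n" by (rule prob_space_path)
  let ?C = "mu * a_bar * learn_const CARD('m) a_bar d_hi growth (r_bar / d_lo)"
  have C0: "0 \<le> ?C" using mu_pos a_bar_nonneg learn_const_nonneg by simp
  have ln0: "0 \<le> ln (real n)" using n by simp
  have "integrable (path n) (flip \<delta> L n q t) \<and> (\<integral>\<omega>. flip \<delta> L n q t \<omega> \<partial>path n) \<le> of_bool (t \<le> 2)
      + 2 * ?C * sqrt (ln (real n)) * (1 / sqrt (real t))"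
  proof (cases "t \<le> 2")
    case True
    then have "flip \<delta> L n q t = (\<lambda>_. 1)" by (auto simp: flip_def)
    then show ?thesis using True C0 ln0 by (simp add: M.prob_space)
  next
    case False
    then have t3: "3 \<le> t" "t \<le> n" using t by auto
    obtain k where k: "k \<in> {1..<L}" "epoch \<delta> L n k < t" "t \<le> min (epoch \<delta> L n (k + 1)) n"
      and e: "1 \<le> epoch \<delta> L n k" "t \<le> 4 * epoch \<delta> L n k"
      by (rule epoch_exists[OF \<delta> L n(1) t3])
    let ?s = "epoch \<delta> L n k"
    have sr: "sample_rule ?s (q k)"
      using q k(1) e(1) by (auto simp: price_rule_def sample_rule_def Let_def)
    have fl: "flip \<delta> L n q t = (\<lambda>\<omega>. \<bar>acc (q k (restrict \<omega> {1..?s})) (\<omega> t) - acc p_star (\<omega> t)\<bar>)"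
      using False by (simp add: flip_def fun_eq_iff tentative_eq[OF \<delta>(1) k] acc_eq_of_bool)
    have sn: "?s \<le> n" using k t3 by linarith
    have "integrable (path n) (flip \<delta> L n q t)"
    proof (rule M.integrable_const_bound[where B = 1])
      show "AE \<omega> in path n. norm (flip \<delta> L n q t \<omega>) \<le> 1" unfolding fl by (auto simp: indicator_def)
      define Q where "Q \<omega> = q k (restrict \<omega> {1..?s})" for \<omega>
      have [measurable]: "Q \<in> borel_measurable (path n)"
        unfolding Q_def by (rule sample_rule_measurable[OF sr]) (use sn in auto)
      have [simp]: "1 \<le> t" "t \<le> n" using t by auto
      show "flip \<delta> L n q t \<in> borel_measurable (path n)"
        unfolding fl acc_eq_of_bool Q_def[symmetric] by measurable
    qed
    moreover have "(\<integral>\<omega>. flip \<delta> L n q t \<omega> \<partial>path n) \<le> 2 * ?C * sqrt (ln (real n)) * (1 / sqrt (real t))"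
    proof -
      have "(\<integral>\<omega>. flip \<delta> L n q t \<omega> \<partial>path n)
        \<le> mu * a_bar * (\<integral>\<omega>. norm (q k (restrict \<omega> {1..?s}) - p_star) \<partial>path n)"
        unfolding fl by (rule expected_flip_le[OF sr k(2) t3(2)])
      also have "\<dots> \<le> mu * a_bar *
          (learn_const CARD('m) a_bar d_hi growth (r_bar / d_lo) * sqrt (ln (real n) / real ?s))"
        using mu_pos a_bar_nonneg by (intro mult_left_mono expected_sample_rule_dist_le[OF sr sn n(2)]) auto
      also have "\<dots> = ?C * sqrt (ln (real n) / real ?s)" by simp
      also have "\<dots> \<le> ?C * (2 * (sqrt (ln (real n)) * (1 / sqrt (real t))))"
      proof (rule mult_left_mono[OF _ C0])
        have "ln (real n) / real ?s \<le> ln (real n) / (real t / 4)"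
          using e t3 ln0 by (intro divide_left_mono) auto
        then have "sqrt (ln (real n) / real ?s) \<le> sqrt (4 * (ln (real n) / real t))"
          by (intro real_sqrt_le_mono) (simp add: mult.commute)
        also have "\<dots> = 2 * (sqrt (ln (real n)) * (1 / sqrt (real t)))"
          by (simp only: real_sqrt_mult real_sqrt_four real_sqrt_divide) simp
        finally show "sqrt (ln (real n) / real ?s) \<le> 2 * (sqrt (ln (real n)) * (1 / sqrt (real t)))" .
      qed
      finally show ?thesis by (simp only: mult_ac)
    qed
    ultimately show ?thesis using False by simp
  qed
  then show "integrable (path n) (flip \<delta> L n q t)"
    "(\<integral>\<omega>. flip \<delta> L n q t \<omega> \<partial>path n) \<le> of_bool (t \<le> 2) + 2 * ?C * sqrt (ln (real n)) * (1 / sqrt (real t))"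
    by auto
qed

lemma integral_overshoot_le:
  assumes T: "T \<le> n" "2 \<le> n"
  shows "integrable (path n) (\<lambda>\<omega>. of_bool (overshoot n i T \<omega>) :: real)"
    and "(\<integral>\<omega>. of_bool (overshoot n i T \<omega>) \<partial>path n) \<le> 2 / (real n)\<^sup>2"
proof -
  interpret M: prob_space "path n" by (rule prob_space_path)
  have comp: "(\<lambda>\<omega>. snd (\<omega> j) $ i * acc p_star (\<omega> j)) \<in> borel_measurable (path n)" if "j \<in> {1..T}" for j
  proof -
    have [measurable]: "(\<lambda>\<omega>. \<omega> j) \<in> measurable (path n) P"
      by (rule measurable_component_singleton) (use that T in auto)
    have "(\<lambda>z. snd z $ i * acc p_star z) \<in> borel_measurable P" by measurable
    from measurable_compose[OF _ this, of "\<lambda>\<omega>. \<omega> j"] show ?thesis by simp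
  qed
  have [measurable]: "Measurable.pred (path n) (overshoot n i T)"
    unfolding overshoot_def using comp by measurable
  show "integrable (path n) (\<lambda>\<omega>. of_bool (overshoot n i T \<omega>) :: real)"
    by (rule M.integrable_const_bound[where B = 1]) auto
  have "(\<integral>\<omega>. of_bool (overshoot n i T \<omega>) \<partial>path n) = measure (path n) {\<omega> \<in> space (path n). overshoot n i T \<omega>}"
    by (rule integral_of_bool) measurable
  also have "\<dots> \<le> 2 * exp (- (2 * ln (real n)))"
    unfolding overshoot_def
  proof (rule hoeffding_PiM[OF prob_space_P])
    show "AE z in P. \<bar>snd z $ i * acc p_star z\<bar> \<le> a_bar"
      using AE_inner_le[of "axis i 1"]
      by eventually_elim (auto simp: inner_axis_eq indicator_def a_bar_nonneg)
  qed (use T in auto)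
  also have "exp (- (2 * ln (real n))) = 1 / (real n)\<^sup>2"
    using T exp_of_nat_mult[of 2 "ln (real n)"] by (simp add: exp_minus divide_inverse)
  finally show "(\<integral>\<omega>. of_bool (overshoot n i T \<omega>) \<partial>path n) \<le> 2 / (real n)\<^sup>2" by simp
qed

text \<open>Every summand has mean \<open>gr p_star p_star\<close>.\<close>

lemma expected_slack:
  "integrable (path n) (\<lambda>\<omega>. \<Sum>j=1..n. d \<bullet> p_star - (snd (\<omega> j) \<bullet> p_star) * acc p_star (\<omega> j))"
  "(\<integral>\<omega>. (\<Sum>j=1..n. d \<bullet> p_star - (snd (\<omega> j) \<bullet> p_star) * acc p_star (\<omega> j)) \<partial>path n) \<le> 0"
proof -
  let ?g = "\<lambda>z. d \<bullet> p_star - (snd z \<bullet> p_star) * acc p_star z"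
  have gi: "integrable P ?g" by (intro Bochner_Integration.integrable_diff integrable_const integrable_inner_acc)
  have ge: "(\<integral>z. ?g z \<partial>P) = gr p_star p_star"
    unfolding gr_def by (subst Bochner_Integration.integral_diff) (auto simp: integrable_inner_acc prob_space)
  note comp = integral_PiM_component[OF prob_space_P _ borel_measurable_integrable[OF gi]]
  have ji: "integrable (path n) (\<lambda>\<omega>. ?g (\<omega> j))" if "j \<in> {1..n}" for j
    using comp(2)[OF that] gi by simp
  show "integrable (path n) (\<lambda>\<omega>. \<Sum>j=1..n. ?g (\<omega> j))"
    by (rule Bochner_Integration.integrable_sum) (rule ji)
  have "(\<integral>\<omega>. (\<Sum>j=1..n. ?g (\<omega> j)) \<partial>path n) = (\<Sum>j=1..n. \<integral>\<omega>. ?g (\<omega> j) \<partial>path n)"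
    by (rule Bochner_Integration.integral_sum) (rule ji)
  also have "\<dots> = (\<Sum>j=1..n. gr p_star p_star)"
    by (intro sum.cong refl) (simp only: comp(1) ge)
  also have "\<dots> \<le> 0" using gr_p_star_p_star by (simp add: mult_nonneg_nonpos)
  finally show "(\<integral>\<omega>. (\<Sum>j=1..n. ?g (\<omega> j)) \<partial>path n) \<le> 0" .
qed

lemma expected_regret_le:
  assumes \<delta>: "1 < \<delta>" "\<delta> \<le> 2" and L: "0 < L" and n: "nat \<lfloor>\<delta> ^ L\<rfloor> = n" "2 \<le> n"
    and b: "b = real n *\<^sub>R d" and q: "price_rule \<delta> L n d q"
  shows "(\<integral>\<omega>. lp_value n b \<omega> - reward n \<omega> (dynamic_policy \<delta> L n b q \<omega>) \<partial>path n)
    \<le> regret_const CARD('m) r_bar a_bar d_lo d_hi growth mu * sqrt (real n) * ln (real n)"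
proof -
  interpret M: prob_space "path n" by (rule prob_space_path)
  let ?m = "real CARD('m)"
  define R where "R = sqrt (real n) * ln (real n)"
  define C where "C = mu * a_bar * learn_const CARD('m) a_bar d_hi growth (r_bar / d_lo)"
  have C0: "0 \<le> C" unfolding C_def using mu_pos a_bar_nonneg learn_const_nonneg by simp
  define w where "w = a_bar * sqrt (2 * real n * (2 * ln (real n)))"
  define A where "A \<omega> = (\<Sum>j=1..n. d \<bullet> p_star - (snd (\<omega> j) \<bullet> p_star) * acc p_star (\<omega> j))" for \<omega>
  define D where "D \<omega> = (\<Sum>t=1..n. flip \<delta> L n q t \<omega>)" for \<omega>
  define Z where "Z \<omega> = (\<Sum>i\<in>(UNIV :: 'm set). \<Sum>T=1..n. of_bool (overshoot n i T \<omega>) :: real)" for \<omega>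
  define U where "U \<omega> = A \<omega> + r_bar * (D \<omega> + (1 + (w + a_bar * D \<omega>) / d_lo + real n * Z \<omega>))" for \<omega>
  define E where "E = 4 + 8 * C"
  have E0: "0 \<le> E" using C0 by (simp add: E_def)
  have ln_half: "1 / 2 \<le> ln (real n)"
  proof -
    have "ln 2 \<le> ln (real n)" using n by simp
    then show ?thesis using ln2_ge_two_thirds by linarith
  qed
  have R1: "1 \<le> 2 * R"
  proof -
    have "1 * (1 / 2) \<le> sqrt (real n) * ln (real n)" using n ln_half by (intro mult_mono) auto
    then show ?thesis by (simp add: R_def)
  qed
  \<comment> \<open>The errors are really of order \<open>sqrt (n * ln n)\<close>; here they are
    relaxed to the claimed rate using \<open>ln n \<ge> 1 / 2\<close>.\<close>
  have sR: "sqrt (real n) * sqrt (ln (real n)) \<le> 2 * R"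
  proof -
    have "ln (real n) * 1 \<le> ln (real n) * (4 * ln (real n))"
      using ln_half by (intro mult_left_mono) auto
    then have "sqrt (ln (real n)) \<le> 2 * ln (real n)"
      using ln_half by (intro real_le_lsqrt) (auto simp: power2_eq_square)
    then have "sqrt (real n) * sqrt (ln (real n)) \<le> sqrt (real n) * (2 * ln (real n))"
      by (intro mult_left_mono) auto
    then show ?thesis by (simp add: R_def)
  qed
  have wR: "w \<le> 4 * a_bar * R"
  proof -
    have "w = a_bar * sqrt (4 * (real n * ln (real n)))" by (simp add: w_def mult_ac)
    also have "\<dots> = 2 * a_bar * (sqrt (real n) * sqrt (ln (real n)))"
      by (simp only: real_sqrt_mult real_sqrt_four mult_ac)
    also have "\<dots> \<le> 2 * a_bar * (2 * R)" using a_bar_nonneg by (intro mult_left_mono sR) auto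
    finally show ?thesis by simp
  qed
  note fl = expected_flip[OF \<delta> L n q]
  have Di: "integrable (path n) D" unfolding D_def by (intro Bochner_Integration.integrable_sum fl(1))
  have DE: "(\<integral>\<omega>. D \<omega> \<partial>path n) \<le> E * R"
  proof -
    have "(\<integral>\<omega>. D \<omega> \<partial>path n) = (\<Sum>t=1..n. \<integral>\<omega>. flip \<delta> L n q t \<omega> \<partial>path n)"
      unfolding D_def by (intro Bochner_Integration.integral_sum fl(1))
    also have "\<dots> \<le> (\<Sum>t=1..n. of_bool (t \<le> 2) + 2 * C * sqrt (ln (real n)) * (1 / sqrt (real t)))"
      unfolding C_def by (intro sum_mono fl(2))
    also have "\<dots> = (\<Sum>t=1..n. of_bool (t \<le> 2)) + 2 * C * sqrt (ln (real n)) * (\<Sum>t=1..n. 1 / sqrt (real t))"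
      by (simp only: sum.distrib sum_distrib_left)
    also have "(\<Sum>t=1..n. of_bool (t \<le> 2)) \<le> (2 :: real)"
    proof -
      have "(\<Sum>t=1..n. of_bool (t \<le> 2)) = real (card {t \<in> {1..n}. t \<le> 2})" by (simp add: Int_def)
      also have "card {t \<in> {1..n}. t \<le> 2} \<le> card {1..2::nat}" by (intro card_mono) auto
      finally show ?thesis by simp
    qed
    also have "2 * C * sqrt (ln (real n)) * (\<Sum>t=1..n. 1 / sqrt (real t)) \<le> 2 * C * sqrt (ln (real n)) * (2 * sqrt (real n))"
      using C0 ln_half by (intro mult_left_mono sum_inverse_sqrt_le) auto
    also have "\<dots> = 4 * C * (sqrt (real n) * sqrt (ln (real n)))" by simp
    also have "\<dots> \<le> 4 * C * (2 * R)" using C0 by (intro mult_left_mono sR) auto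
    finally show ?thesis using R1 by (simp add: E_def algebra_simps)
  qed
  have oi: "integrable (path n) (\<lambda>\<omega>. of_bool (overshoot n i T \<omega>) :: real)" if "T \<in> {1..n}" for i T
    using that n(2) by (intro integral_overshoot_le) auto
  have Zi: "integrable (path n) Z"
    unfolding Z_def by (intro Bochner_Integration.integrable_sum oi)
  have ZE: "real n * (\<integral>\<omega>. Z \<omega> \<partial>path n) \<le> 4 * ?m * R"
  proof -
    have "(\<integral>\<omega>. Z \<omega> \<partial>path n)
        = (\<Sum>i\<in>(UNIV :: 'm set). \<integral>\<omega>. (\<Sum>T=1..n. of_bool (overshoot n i T \<omega>)) \<partial>path n)"
      unfolding Z_def by (intro Bochner_Integration.integral_sum Bochner_Integration.integrable_sum oi)
    also have "\<dots> = (\<Sum>i\<in>(UNIV :: 'm set). \<Sum>T=1..n. \<integral>\<omega>. of_bool (overshoot n i T \<omega>) \<partial>path n)"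
      by (intro sum.cong refl Bochner_Integration.integral_sum oi)
    also have "\<dots> \<le> (\<Sum>i\<in>(UNIV :: 'm set). \<Sum>T=1..n. 2 / (real n)\<^sup>2)"
      using n(2) by (intro sum_mono integral_overshoot_le) auto
    also have "\<dots> = ?m * 2 / real n" using n by (simp add: power2_eq_square)
    finally have "real n * (\<integral>\<omega>. Z \<omega> \<partial>path n) \<le> 2 * ?m * 1" using n by (simp add: field_simps)
    also have "\<dots> \<le> 2 * ?m * (2 * R)" by (intro mult_left_mono R1) auto
    finally show ?thesis by simp
  qed
  have Ai: "integrable (path n) A" and AE: "(\<integral>\<omega>. A \<omega> \<partial>path n) \<le> 0"
    unfolding A_def by (rule expected_slack)+
  have Ui: "integrable (path n) U"
    unfolding U_def using Ai Di Zi by auto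
  have "(\<integral>\<omega>. U \<omega> \<partial>path n) = (\<integral>\<omega>. A \<omega> \<partial>path n)
    + r_bar * ((\<integral>\<omega>. D \<omega> \<partial>path n) + (1 + (w + a_bar * (\<integral>\<omega>. D \<omega> \<partial>path n)) / d_lo + real n * (\<integral>\<omega>. Z \<omega> \<partial>path n)))"
    unfolding U_def using Ai Di Zi by (simp add: M.prob_space)
  also have "\<dots> \<le> 0 + r_bar * (E * R + (2 * R + (4 * a_bar * R + a_bar * (E * R)) / d_lo + 4 * ?m * R))"
    using AE DE ZE wR R1 r_bar_nonneg a_bar_nonneg d_lo_pos
    by (intro add_mono mult_left_mono divide_right_mono) auto
  also have "\<dots> = regret_const CARD('m) r_bar a_bar d_lo d_hi growth mu * R"
    unfolding regret_const_def Let_def C_def[symmetric] E_def[symmetric]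
    by (simp add: algebra_simps add_divide_distrib)
  finally have UE: "(\<integral>\<omega>. U \<omega> \<partial>path n) \<le> regret_const CARD('m) r_bar a_bar d_lo d_hi growth mu * R" .
  have K0: "0 \<le> regret_const CARD('m) r_bar a_bar d_lo d_hi growth mu * R"
    unfolding regret_const_def Let_def C_def[symmetric] E_def[symmetric]
    using E0 R1 r_bar_nonneg a_bar_nonneg d_lo_pos
    by (intro mult_nonneg_nonneg add_nonneg_nonneg divide_nonneg_nonneg) auto
  have "AE \<omega> in path n. regular {1..n} \<omega>" by (rule AE_regular) auto
  then have "AE \<omega> in path n. lp_value n b \<omega> - reward n \<omega> (dynamic_policy \<delta> L n b q \<omega>) \<le> U \<omega>"
  proof eventually_elim
    case (elim \<omega>)
    show ?case
      unfolding dynamic_policy_def U_def A_def D_def Z_def w_def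
      by (rule regret_pathwise_le[OF n(2) elim b]) (rule tentative_01 abs_tentative_diff_le_flip)+
  qed
  from integral_le_nonneg_bound[OF Ui this UE K0] show ?thesis by (simp add: R_def mult_ac)
qed

end

theorem theorem4:
  fixes r_bar a_bar d_lo d_hi lam_min lam mu :: real
  assumes "0 < d_lo" and "d_lo < d_hi" and "0 < lam_min" and "0 < lam" and "0 < mu"
  shows "\<exists>K::real. \<forall>(n::nat) (b::real ^ 'm) (d::real ^ 'm) (\<delta>::real) (L::nat) q.
           CARD('m) < n \<longrightarrow> (\<forall>i. 0 < b $ i) \<longrightarrow>
           d = (1 / real n) *\<^sub>R b \<longrightarrow> d \<in> Omega_d d_lo d_hi \<longrightarrow>
           1 < \<delta> \<longrightarrow> \<delta> \<le> 2 \<longrightarrow> 0 < L \<longrightarrow> nat \<lfloor>\<delta> ^ L\<rfloor> = n \<longrightarrow>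
           price_rule \<delta> L n d q \<longrightarrow>
           worst_case_regret (Xi r_bar a_bar d_lo d_hi lam_min lam mu d) n b
             (dynamic_policy \<delta> L n b q)
           \<le> ereal (K * sqrt (real n) * ln (real n))"
proof (intro exI allI impI)
  fix n :: nat and b d :: "real ^ 'm" and \<delta> :: real and L :: nat
    and q :: "nat \<Rightarrow> 'm sample_path \<Rightarrow> real ^ 'm"
  assume n: "CARD('m) < n" and d: "d = (1 / real n) *\<^sub>R b" "d \<in> Omega_d d_lo d_hi"
    and \<delta>: "1 < \<delta>" "\<delta> \<le> 2" and L: "0 < L" "nat \<lfloor>\<delta> ^ L\<rfloor> = n" and q: "price_rule \<delta> L n d q"
  have "0 < CARD('m)" by simp
  \<comment> \<open>At least one constraint exists, so \<open>n \<ge> 2\<close> and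
    \<open>ln n\<close> stays away from 0.\<close>
  with n have n2: "2 \<le> n" by linarith
  have b: "b = real n *\<^sub>R d" using n by (simp add: d(1))
  \<comment> \<open>The witness for \<open>K\<close> involves only the dimension and the class
    constants, as the order of quantifiers demands.\<close>
  show "worst_case_regret (Xi r_bar a_bar d_lo d_hi lam_min lam mu d) n b (dynamic_policy \<delta> L n b q)
    \<le> ereal (regret_const CARD('m) r_bar a_bar d_lo d_hi (lam * lam_min / 4) mu * sqrt (real n) * ln (real n))"
    unfolding worst_case_regret_def
  proof (rule SUP_least)
    fix P assume "P \<in> Xi r_bar a_bar d_lo d_hi lam_min lam mu d"
    then interpret online_lp P r_bar a_bar d_lo d_hi lam_min lam mu d
      using assms d(2) by unfold_locales
    show "ereal (\<integral>\<omega>. lp_value n b \<omega> - reward n \<omega> (dynamic_policy \<delta> L n b q \<omega>) \<partial>path n)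
      \<le> ereal (regret_const CARD('m) r_bar a_bar d_lo d_hi growth mu * sqrt (real n) * ln (real n))"
      using expected_regret_le[OF \<delta> L n2 b q] by simp
  qed
qed

end
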